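(* Let $q>3$ be a prime power and let $t>1$ be an integer. Let $L=L_U$ be a scattered $\mathbb F_q$-linear set of maximum rank $t$ in $\mathrm{PG}(1,q^t)$, and let $c=c_\Gamma(L)$ be its $\Gamma\mathrm L$-class. Then $L$ gives rise to $c$ pairwise non-isomorphic translation planes; that is, there exist a projectivity $\kappa$ of $\mathrm{PG}(1,q^t)$ and scattered $\mathbb F_q$-linearized polynomials $f_1(x),\dots,f_c(x)\in\mathbb F_{q^t}[x]$ such that $L_{U_{f_i}}=\kappa(L)$ for every $i\in\{1,\dots,c\}$ and the translation planes $\mathcal A_{f_1},\dots,\mathcal A_{f_c}$ are pairwise non-isomorphic.
   Context: For an $\mathbb F_q$-subspace $U$ of $\mathbb F_{q^t}^2$ of $\mathbb F_q$-dimension $r>0$, the $\mathbb F_q$-linear set of rank $r$ defined by $U$ is the point set $L_U=\{\langle v\rangle_{\mathbb F_{q^t}} : v\in U\setminus\{0\}\}$ of $\mathrm{PG}(1,q^t)$. It is scattered if $\#L_U=(q^r-1)/(q-1)$, equivalently $\dim_{\mathbb F_q}(U\cap\langle v\rangle_{\mathbb F_{q^t}})\le 1$ for every $v\in\mathbb F_{q^t}^2$. Scattered linear sets in $\mathrm{PG}(1,q^t)$ have rank at most $t$; those of rank $t$ are said to be of maximum rank. Let $\Gamma\mathrm L(2,q^t)$ be the group of bijective $\mathbb F_{q^t}$-semilinear maps of $\mathbb F_{q^t}^2$. For an $\mathbb F_q$-linear set $L$ of maximum rank in $\mathrm{PG}(1,q^t)$ whose maximum field of linearity is $\mathbb F_q$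 (i.e. $L$ is not an $\mathbb F_{q^r}$-linear set for any $r>1$; this is the case for scattered $L$ of maximum rank), the $\Gamma\mathrm L$-class $c_\Gamma(L)$ is the largest integer $c$ such that there exist $\mathbb F_q$-subspaces $U_1,\dots,U_c$ of $\mathbb F_{q^t}^2$ with $L_{U_i}=L$ for all $i$ and such that for $i\ne j$ there is no $\kappa\in\Gamma\mathrm L(2,q^t)$ with $U_i=\kappa(U_j)$. An $\mathbb F_q$-linearized polynomial in $\mathbb F_{q^t}[x]$ is one of the form $f(x)=\sum_{i=0}^k a_ix^{q^i}$. It is scattered if for all $y,z\in\mathbb F_{q^t}$ the condition $zf(y)-yf(z)=0$ implies that $y$ and $z$ are $\mathbb F_q$-linearly dependent. For a scattered $f$ put $U_f=\{(x,f(x)) : x\in\mathbb F_{q^t}\}$ and $L_f=\{f(x)/x : x\in\mathbb F_{q^t}^*\}\subseteq\mathbb F_{q^t}$ (the nonhomogeneous coordinates of the points of $L_{U_f}$). A planar spread of a vector space $\mathbb V$ is a collection $\mathcal B$ of at least three subspaces such that $\mathbb V=V\oplus V'$ for all distinct $V,V'\in\mathcal B$ and every vector of $\mathbb V$ lies in some member of $\mathcal B$. The translation plane $\mathcal A(\mathcal B)$ is the affine plane whose points are the vectors of $\mathbb V$ and whose lines are the cosets $V+w$ ($V\in\mathcal B$, $w\in\mathbb V$). Let $\mathcal B_f$ be the collection consisting of the following subspaces of $\mathbb F_{q^t}^2$: $\langle(1,m)\rangle_{\mathbb F_{q^t}}$ for $m\in\mathbb F_{q^t}\setminus L_f$; $hU_f=\{hv:v\in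 U_f\}$ for $h\in\mathbb F_{q^t}^*$; and $\{0\}\times\mathbb F_{q^t}$. This is a planar spread of $\mathbb F_{q^t}^2$ (as an $\mathbb F_q$-vector space), and the translation plane associated with $f$ is $\mathcal A_f=\mathcal A(\mathcal B_f)$. Two planes are isomorphic if there is a bijection between their point sets that maps lines onto lines (in both directions). *)

theory Defs
  imports
    Complex_Main
    "HOL-Library.Product_Plus"
    "HOL-Computational_Algebra.Polynomial"
    "HOL-Number_Theory.Prime_Powers"
begin

text \<open>
  The field of order \<open>q ^ t\<close> is a finite field type \<open>'a\<close>, and the field of order \<open>q\<close> is a subfield
  \<open>K :: 'a set\<close> of it, so that \<open>q = card K\<close>. The plane over \<open>'a\<close> is \<open>'a \<times> 'a\<close>.
\<close>

definition is_subfield :: "'a::field set \<Rightarrow> bool" where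
  "is_subfield K \<longleftrightarrow> 0 \<in> K \<and> 1 \<in> K \<and>
     (\<forall>x\<in>K. \<forall>y\<in>K. x + y \<in> K \<and> x * y \<in> K) \<and> (\<forall>x\<in>K. - x \<in> K \<and> inverse x \<in> K)"

definition smul :: "'a::field \<Rightarrow> 'a \<times> 'a \<Rightarrow> 'a \<times> 'a" where
  "smul a v = (a * fst v, a * snd v)"

lemma vector_space_smul: "vector_space (smul :: 'a::field \<Rightarrow> _)"
  by unfold_locales (auto simp: smul_def algebra_simps)

definition K_subspace :: "'a::field set \<Rightarrow> ('a \<times> 'a) set \<Rightarrow> bool" where
  "K_subspace K U \<longleftrightarrow> 0 \<in> U \<and> (\<forall>u\<in>U. \<forall>v\<in>U. u + v \<in> U) \<and> (\<forall>a\<in>K. \<forall>u\<in>U. smul a u \<in> U)"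

text \<open>\<open>U\<close> has a basis over \<open>K\<close> with \<open>r\<close> elements.\<close>

definition K_dim :: "'a::field set \<Rightarrow> ('a \<times> 'a) set \<Rightarrow> nat \<Rightarrow> bool" where
  "K_dim K U r \<longleftrightarrow>
     (\<exists>b :: nat \<Rightarrow> 'a \<times> 'a.
        U = {(\<Sum>i<r. smul (a i) (b i)) | a. \<forall>i<r. a i \<in> K} \<and>
        (\<forall>a. (\<forall>i<r. a i \<in> K) \<and> (\<Sum>i<r. smul (a i) (b i)) = 0 \<longrightarrow> (\<forall>i<r. a i = 0)))"


subsection \<open>Linear sets of the projective line\<close>

text \<open>A point of the projective line is a one-dimensional subspace, i.e. a \<open>proj_pt v\<close> with \<open>v \<noteq> 0\<close>.\<close>

definition proj_pt :: "'a::field \<times> 'a \<Rightarrow> ('a \<times> 'a) set" where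
  "proj_pt v = {smul a v | a. True}"

definition lin_set :: "('a::field \<times> 'a) set \<Rightarrow> ('a \<times> 'a) set set" where
  "lin_set U = {proj_pt v | v. v \<in> U - {0}}"

definition linear_set_of_rank :: "'a::field set \<Rightarrow> nat \<Rightarrow> ('a \<times> 'a) set set \<Rightarrow> bool" where
  "linear_set_of_rank K r L \<longleftrightarrow>
     r > 0 \<and> (\<exists>U. K_subspace K U \<and> K_dim K U r \<and> L = lin_set U)"

text \<open>The division is exact: \<open>q - 1\<close> divides \<open>q ^ r - 1\<close>.\<close>

definition scattered_linear_set :: "'a::field set \<Rightarrow> nat \<Rightarrow> ('a \<times> 'a) set set \<Rightarrow> bool" where
  "scattered_linear_set K r L \<longleftrightarrow>
     linear_set_of_rank K r L \<and> card L = (card K ^ r - 1) div (card K - 1)"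

definition GammaL :: "('a::field \<times> 'a \<Rightarrow> 'a \<times> 'a) set" where
  "GammaL = {\<kappa>. bij \<kappa> \<and> (\<forall>u v. \<kappa> (u + v) = \<kappa> u + \<kappa> v) \<and>
     (\<exists>\<sigma> :: 'a \<Rightarrow> 'a. bij \<sigma> \<and> (\<forall>x y. \<sigma> (x + y) = \<sigma> x + \<sigma> y) \<and> (\<forall>x y. \<sigma> (x * y) = \<sigma> x * \<sigma> y) \<and>
        (\<forall>a v. \<kappa> (smul a v) = smul (\<sigma> a) (\<kappa> v)))}"

text \<open>
  The number \<open>c\<close> in the definition is bounded, as the subspaces \<open>U i\<close> are pairwise distinct
  (the identity is in \<open>GammaL\<close>) and \<open>'a\<close> is finite. So the greatest such \<open>c\<close> exists.
\<close>

definition GammaL_class :: "'a::{field,finite} set \<Rightarrow> ('a \<times> 'a) set set \<Rightarrow> nat" where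
  "GammaL_class K L = (GREATEST c. \<exists>U :: nat \<Rightarrow> ('a \<times> 'a) set.
     (\<forall>i\<in>{1..c}. K_subspace K (U i) \<and> lin_set (U i) = L) \<and>
     (\<forall>i\<in>{1..c}. \<forall>j\<in>{1..c}. i \<noteq> j \<longrightarrow> \<not> (\<exists>\<kappa>\<in>GammaL. U i = \<kappa> ` U j)))"

text \<open>
  A projectivity is represented by a map on all sets of vectors; only its values on points are
  specified.
\<close>

definition projectivity :: "(('a::field \<times> 'a) set \<Rightarrow> ('a \<times> 'a) set) \<Rightarrow> bool" where
  "projectivity \<kappa> \<longleftrightarrow>
     (\<exists>\<phi>. Vector_Spaces.linear smul smul \<phi> \<and> bij \<phi> \<and> (\<forall>v. v \<noteq> 0 \<longrightarrow> \<kappa> (proj_pt v) = proj_pt (\<phi> v)))"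


subsection \<open>Scattered linearized polynomials\<close>

definition linearized :: "'a::field set \<Rightarrow> 'a poly \<Rightarrow> bool" where
  "linearized K f \<longleftrightarrow> (\<exists>(k::nat) a. f = (\<Sum>i\<le>k. monom (a i) (card K ^ i)))"

definition scattered_poly :: "'a::field set \<Rightarrow> 'a poly \<Rightarrow> bool" where
  "scattered_poly K f \<longleftrightarrow>
     (\<forall>y z. z * poly f y - y * poly f z = 0 \<longrightarrow>
        (\<exists>a\<in>K. \<exists>b\<in>K. (a, b) \<noteq> (0, 0) \<and> a * y + b * z = 0))"

definition U_poly :: "'a::field poly \<Rightarrow> ('a \<times> 'a) set" where
  "U_poly f = {(x, poly f x) | x. True}"

definition L_poly :: "'a::field poly \<Rightarrow> 'a set" where
  "L_poly f = {poly f x / x | x. x \<noteq> 0}"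


subsection \<open>Translation planes\<close>

text \<open>A plane is given by its point set and its set of lines.\<close>

type_synonym 'p plane = "'p set \<times> 'p set set"

definition translation_plane :: "'v::ab_group_add set set \<Rightarrow> 'v plane" where
  "translation_plane B = (UNIV, {{v + w | v. v \<in> V} | V w. V \<in> B})"

definition planes_isomorphic :: "'p plane \<Rightarrow> 'r plane \<Rightarrow> bool" where
  "planes_isomorphic P Q \<longleftrightarrow>
     (\<exists>g. bij_betw g (fst P) (fst Q) \<and>
        (\<forall>l\<in>snd P. g ` l \<in> snd Q) \<and> (\<forall>m\<in>snd Q. inv_into (fst P) g ` m \<in> snd P))"

definition spread_of_poly :: "'a::field poly \<Rightarrow> ('a \<times> 'a) set set" where
  "spread_of_poly f =
     {proj_pt (1, m) | m. m \<notin> L_poly f} \<union>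
     {smul h ` U_poly f | h. h \<noteq> 0} \<union>
     {{0} \<times> UNIV}"

definition plane_of_poly :: "'a::field poly \<Rightarrow> ('a \<times> 'a) plane" where
  "plane_of_poly f = translation_plane (spread_of_poly f)"

end

theory Submission
  imports Defs
begin

text \<open>
  An isomorphism of two translation planes that fixes the origin preserves parallelograms, so it is an
  additive bijection between the spreads. In \<open>\<B>\<^sub>f\<close> all but at most a third of the points of the
  projective line survive when \<open>q > 3\<close>, so this bijection maps more than \<open>\<surd>(q\<^sup>t) + 1\<close> of them to points;
  the slopes for which this happens form, after normalisation, a subfield, which must then be the
  whole field. Hence the bijection is semilinear and maps \<open>U\<^sub>f\<close> to a multiple of \<open>U\<^sub>g\<close>.

  Any \<open>U\<close> with \<open>L\<^sub>U = L\<close> has \<open>q\<^sup>t\<close> elements, since a larger one would meet every point.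
  A projectivity moving a point off \<open>L\<close> to infinity turns all of them into graphs.
\<close>

text \<open>An isomorphism of the planes is a priori only additive and need not respect the scalars
  of the big field; the points lying in the spreads are what recovers them. Write N = q^t. The
  spread of f lacks only the points of L_f, at most (N - 1)/(q - 1) of them, and the spread of g has
  at most (N - 1)/(q - 1) components h U_g to which a point can be lost. For q > 3 at least N + 1 -
  2(N - 1)/3 = (N + 5)/3 points therefore go to points, and the square of one less than this exceeds
  N, whereas the square of the order of a proper subfield is at most N. For q = 3 the same estimate
  leaves only two points, too few even for a frame.\<close>

section \<open>Isomorphisms of translation planes\<close>

text \<open>Members are only asked to be subgroups, because isomorphisms are known to respect
  nothing but addition. Properness together with covering forces at least three members, as a group
  is not the union of two proper subgroups.\<close>

definition planar_spread :: "'v::ab_group_add set set \<Rightarrow> bool" where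
  "planar_spread B \<longleftrightarrow>
     (\<forall>V\<in>B. 0 \<in> V \<and> V \<noteq> UNIV \<and> (\<forall>x\<in>V. \<forall>y\<in>V. x - y \<in> V)) \<and>
     (\<forall>V\<in>B. \<forall>W\<in>B. V \<noteq> W \<longrightarrow> V \<inter> W = {0} \<and> (\<forall>x. \<exists>v\<in>V. \<exists>w\<in>W. x = v + w)) \<and>
     (\<forall>x. \<exists>V\<in>B. x \<in> V)"

context
  fixes B :: "'v::ab_group_add set set"
  assumes B: "planar_spread B"
begin

lemma planar_spread_diff: "V \<in> B \<Longrightarrow> x \<in> V \<Longrightarrow> y \<in> V \<Longrightarrow> x - y \<in> V"
  using B unfolding planar_spread_def by simp

lemma planar_spread_zero: "V \<in> B \<Longrightarrow> 0 \<in> V"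
  using B unfolding planar_spread_def by simp

lemma planar_spread_proper: "V \<in> B \<Longrightarrow> \<exists>x. x \<notin> V"
  using B unfolding planar_spread_def by auto

lemma planar_spread_Int: "V \<in> B \<Longrightarrow> W \<in> B \<Longrightarrow> V \<noteq> W \<Longrightarrow> x \<in> V \<Longrightarrow> x \<in> W \<Longrightarrow> x = 0"
proof -
  assume "V \<in> B" "W \<in> B" "V \<noteq> W" and x: "x \<in> V" "x \<in> W"
  hence "V \<inter> W = {0}" using B unfolding planar_spread_def by simp
  thus ?thesis using x by blast
qed

lemma planar_spread_sum: "V \<in> B \<Longrightarrow> W \<in> B \<Longrightarrow> V \<noteq> W \<Longrightarrow> \<exists>v\<in>V. \<exists>w\<in>W. x = v + w"
  using B unfolding planar_spread_def by simp

lemma planar_spread_cover: "\<exists>V\<in>B. x \<in> V"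
  using B unfolding planar_spread_def by simp

lemma planar_spread_minus: "V \<in> B \<Longrightarrow> x \<in> V \<Longrightarrow> - x \<in> V"
  using planar_spread_diff[of V 0 x] planar_spread_zero[of V] by simp

lemma planar_spread_add: "V \<in> B \<Longrightarrow> x \<in> V \<Longrightarrow> y \<in> V \<Longrightarrow> x + y \<in> V"
  using planar_spread_diff[of V x "- y"] planar_spread_minus[of V y] by simp

end

lemma mem_coset_iff: "y \<in> {v + a | v. v \<in> X} \<longleftrightarrow> y - a \<in> X" for a :: "'v::ab_group_add"
  by (auto intro!: exI[of _ "y - a"])

lemma planes_isomorphic_imp_additive:
  fixes B :: "'v::ab_group_add set set" and B' :: "'w::ab_group_add set set"
  assumes B: "planar_spread B" and B': "planar_spread B'"
    and iso: "planes_isomorphic (translation_plane B) (translation_plane B')"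
  shows "\<exists>\<phi>. bij \<phi> \<and> (\<forall>x y. \<phi> (x + y) = \<phi> x + \<phi> y) \<and> (\<forall>V\<in>B. \<phi> ` V \<in> B')"
proof -
  obtain g where "bij_betw g UNIV UNIV"
    and lines: "\<forall>l\<in>{{v + w | v. v \<in> V} | V w. V \<in> B}. g ` l \<in> {{v + w | v. v \<in> V} | V w. V \<in> B'}"
    using iso unfolding planes_isomorphic_def translation_plane_def by auto
  have g: "\<exists>V' w'. V' \<in> B' \<and> g ` {v + w | v. v \<in> V} = {v + w' | v. v \<in> V'}" if V: "V \<in> B" for V w
  proof -
    have "{v + w | v. v \<in> V} \<in> {{v + w | v. v \<in> V} | V w. V \<in> B}" using V by blast
    from lines[rule_format, OF this] show ?thesis by blast
  qed
  \<comment> \<open>Translations are automorphisms of the target plane, so the origin may be assumed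
    fixed.\<close>
  define \<phi> where "\<phi> x = g x - g 0" for x
  have "bij ((\<lambda>y. y - g 0) \<circ> g)"
    using \<open>bij_betw g UNIV UNIV\<close>
    by (intro bij_comp) (auto intro!: bij_betwI[where g = "\<lambda>y. y + g 0"])
  hence bij: "bij \<phi>" by (simp add: \<phi>_def[abs_def] comp_def)
  hence inj: "\<phi> x = \<phi> y \<longleftrightarrow> x = y" for x y by (simp add: bij_is_inj inj_eq)
  have \<phi>0: "\<phi> 0 = 0" by (simp add: \<phi>_def)
  \<comment> \<open>\<open>V'\<close> may still depend on \<open>w\<close> here;
    \<open>parallel\<close> below shows that it does not.\<close>
  have line: "\<exists>V'\<in>B'. \<forall>z. (\<exists>x. z = \<phi> x \<and> x - w \<in> V) \<longleftrightarrow> z - \<phi> w \<in> V'" if V: "V \<in> B" for V w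
  proof -
    obtain V' w' where V': "V' \<in> B'" and eq: "g ` {v + w | v. v \<in> V} = {v + w' | v. v \<in> V'}"
      using g[OF V, of w] by (elim exE conjE)
    have mem: "(\<exists>x. y = g x \<and> x - w \<in> V) \<longleftrightarrow> y - w' \<in> V'" for y
    proof -
      have "(\<exists>x. y = g x \<and> x - w \<in> V) \<longleftrightarrow> y \<in> g ` {v + w | v. v \<in> V}"
        unfolding image_iff Bex_def mem_coset_iff by blast
      also have "\<dots> \<longleftrightarrow> y - w' \<in> V'"
        unfolding eq mem_coset_iff ..
      finally show ?thesis .
    qed
    have w: "g w - w' \<in> V'" using mem[of "g w"] planar_spread_zero[OF B V] by auto
    have "y - w' \<in> V' \<longleftrightarrow> y - g w \<in> V'" for y
    proof
      assume "y - w' \<in> V'"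
      from planar_spread_diff[OF B' V' this w] show "y - g w \<in> V'" by simp
    next
      assume "y - g w \<in> V'"
      from planar_spread_add[OF B' V' this w] show "y - w' \<in> V'" by simp
    qed
    hence mem': "(\<exists>x. y = g x \<and> x - w \<in> V) \<longleftrightarrow> y - g w \<in> V'" for y using mem by simp
    have "(\<exists>x. z = \<phi> x \<and> x - w \<in> V) \<longleftrightarrow> z - \<phi> w \<in> V'" for z
      using mem'[of "z + g 0"] unfolding \<phi>_def by (auto simp: algebra_simps)
    thus ?thesis using V' by blast
  qed
  have comp: "\<phi> ` V \<in> B'" if V: "V \<in> B" for V
  proof -
    from line[OF V, of 0] obtain V' where "V' \<in> B'"
      and z: "\<And>z. (\<exists>x. z = \<phi> x \<and> x \<in> V) \<longleftrightarrow> z \<in> V'" by (auto simp: \<phi>0)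
    have "\<phi> ` V = V'" using z by blast
    thus ?thesis using \<open>V' \<in> B'\<close> by simp
  qed
  have parallel: "\<phi> x - \<phi> w \<in> \<phi> ` V" if V: "V \<in> B" and x: "x - w \<in> V" for V x w
  proof -
    obtain V' where V': "V' \<in> B'" and z: "\<And>z. (\<exists>x. z = \<phi> x \<and> x - w \<in> V) \<longleftrightarrow> z - \<phi> w \<in> V'"
      using line[OF V, of w] by blast
    have "V' = \<phi> ` V"
    proof (rule ccontr)
      assume ne: "V' \<noteq> \<phi> ` V"
      \<comment> \<open>Otherwise the images of \<open>V\<close> and of its parallel through
        \<open>w\<close> meet in \<open>b\<close>. Pulling \<open>b\<close> back puts
        \<open>w\<close> into \<open>V\<close>, so the image of \<open>V\<close> lies in
        \<open>V'\<close>. It is then trivial, and \<open>V'\<close> would be the whole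
        group.\<close>
      obtain a b where a: "a \<in> V'" and b: "b \<in> \<phi> ` V" and "\<phi> w = a + b"
        using planar_spread_sum[OF B' V' comp[OF V] ne, of "\<phi> w"] by blast
      hence "b - \<phi> w \<in> V'" using planar_spread_minus[OF B' V' a] by simp
      then obtain y where y: "b = \<phi> y" "y - w \<in> V" using z by blast
      have "y \<in> V" using b y inj by auto
      with y have wV: "w \<in> V" using planar_spread_diff[OF B V, of y "y - w"] by simp
      have "- \<phi> w \<in> V'"
        using z[of 0] \<phi>0 planar_spread_minus[OF B V wV] by (metis diff_0)
      hence w': "\<phi> w \<in> V'" using planar_spread_minus[OF B' V'] by fastforce
      have "u \<in> V'" if u: "u \<in> \<phi> ` V" for u
      proof -
        obtain v where v: "u = \<phi> v" "v \<in> V" using u by blast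
        have "u - \<phi> w \<in> V'" using z v planar_spread_diff[OF B V _ wV] by blast
        from planar_spread_add[OF B' V' this w'] show ?thesis by simp
      qed
      hence trivial: "\<phi> ` V = {0}"
        using planar_spread_Int[OF B' V' comp[OF V] ne] planar_spread_zero[OF B' comp[OF V]] by blast
      obtain u where u: "u \<notin> V'" using planar_spread_proper[OF B' V'] by blast
      obtain p r where "p \<in> V'" "r \<in> \<phi> ` V" "u = p + r"
        using planar_spread_sum[OF B' V' comp[OF V] ne] by blast
      thus False using u trivial by simp
    qed
    thus ?thesis using z x by blast
  qed
  \<comment> \<open>The vector \<open>v + w\<close> is where the parallel to \<open>V\<close>
    through \<open>w\<close> meets the parallel to \<open>W\<close> through
    \<open>v\<close>.\<close>
  have add_distinct: "\<phi> (v + w) = \<phi> v + \<phi> w" if "V \<in> B" "v \<in> V" "w \<notin> V" for V v w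
  proof -
    obtain W where W: "W \<in> B" "w \<in> W" using planar_spread_cover[OF B] by blast
    hence "V \<noteq> W" using that by blast
    hence ne: "\<phi> ` V \<noteq> \<phi> ` W" using bij by (simp add: bij_is_inj inj_image_eq_iff)
    have "\<phi> (v + w) - \<phi> w - \<phi> v \<in> \<phi> ` V"
      using parallel[of V "v + w" w] that planar_spread_diff[OF B' comp[OF that(1)]] by simp
    moreover have "\<phi> (v + w) - \<phi> v - \<phi> w \<in> \<phi> ` W"
      using parallel[of W "v + w" v] W planar_spread_diff[OF B' comp[OF W(1)]] by simp
    hence "\<phi> (v + w) - \<phi> w - \<phi> v \<in> \<phi> ` W" by (simp add: algebra_simps)
    ultimately have "\<phi> (v + w) - \<phi> w - \<phi> v = 0"
      using planar_spread_Int[OF B' comp comp ne] that W by blast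
    thus ?thesis by (simp add: algebra_simps)
  qed
  have "\<phi> (v + w) = \<phi> v + \<phi> w" for v w
  proof -
    obtain V where V: "V \<in> B" "v \<in> V" using planar_spread_cover[OF B] by blast
    show ?thesis
    proof (cases "w \<in> V")
      case True
      \<comment> \<open>Both \<open>u\<close> and \<open>w + u\<close> lie outside \<open>V\<close>,
        so every sum below is covered by \<open>add_distinct\<close>.\<close>
      obtain u where u: "u \<notin> V" using planar_spread_proper[OF B V(1)] by blast
      have wu: "w + u \<notin> V" using planar_spread_diff[OF B V(1) _ True, of "w + u"] u by auto
      have "\<phi> (v + w) + \<phi> u = \<phi> (v + w + u)"
        using add_distinct[of V "v + w" u] V True u planar_spread_add[OF B V(1)] by simp
      also have "\<dots> = \<phi> (v + (w + u))" by (simp add: algebra_simps)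
      also have "\<dots> = \<phi> v + (\<phi> w + \<phi> u)"
        using add_distinct[OF V wu] add_distinct[OF V(1) True u] by simp
      finally show ?thesis by (simp add: algebra_simps)
    next
      case False
      thus ?thesis using add_distinct V by blast
    qed
  qed
  thus ?thesis using bij comp by blast
qed

section \<open>Scalar multiples and points\<close>

interpretation smul: vector_space "smul :: 'a::field \<Rightarrow> _"
  by (rule vector_space_smul)

lemma proj_pt_iff: "v \<in> proj_pt u \<longleftrightarrow> (\<exists>a. v = smul a u)"
  by (auto simp: proj_pt_def)

lemma smul_inverse_smul: "a \<noteq> 0 \<Longrightarrow> smul (inverse a) (smul a v) = v"
  "a \<noteq> 0 \<Longrightarrow> smul a (smul (inverse a) v) = v"
  by simp_all

lemma proj_pt_eqI: "v \<noteq> 0 \<Longrightarrow> v = smul a u \<Longrightarrow> proj_pt v = proj_pt u"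
proof -
  assume v: "v \<noteq> 0" "v = smul a u"
  hence a: "a \<noteq> 0" by auto
  hence "smul b u = smul (b / a) v" for b using v by simp
  moreover have "smul b v = smul (b * a) u" for b using v by simp
  ultimately show ?thesis unfolding proj_pt_def by blast
qed

lemma proj_pt_eq_iff: "v \<noteq> 0 \<Longrightarrow> proj_pt v = proj_pt u \<longleftrightarrow> (\<exists>a. v = smul a u)"
  using proj_pt_eqI proj_pt_iff smul.scale_one by metis

lemma proj_pt_eqI_det:
  assumes "v \<noteq> 0" "w \<noteq> 0" "fst w * snd v = snd w * fst v"
  shows "proj_pt v = proj_pt w"
proof (cases "fst w = 0")
  case True
  hence "snd w \<noteq> 0" using assms(2) by (simp add: prod_eq_iff)
  hence "v = smul (snd v / snd w) w" using True assms(3) by (simp add: smul_def prod_eq_iff)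
  thus ?thesis using assms proj_pt_eqI by blast
next
  case False
  hence "v = smul (fst v / fst w) w" using assms(3) by (simp add: smul_def prod_eq_iff field_simps)
  thus ?thesis using assms proj_pt_eqI by blast
qed

text \<open>Cramer's rule; the determinant is nonzero because the points differ.\<close>

lemma proj_pt_decompose:
  assumes "u \<noteq> 0" "v \<noteq> 0" "proj_pt u \<noteq> proj_pt v"
  shows "\<exists>a b. w = smul a u + smul b v"
proof -
  define d where "d = fst u * snd v - snd u * fst v"
  have "d \<noteq> 0" using proj_pt_eqI_det[OF assms(2,1)] assms(3) unfolding d_def by auto
  hence "w = smul ((fst w * snd v - snd w * fst v) / d) u + smul ((fst u * snd w - snd u * fst w) / d) v"
    by (simp add: smul_def prod_eq_iff divide_simps) (simp add: d_def algebra_simps)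
  thus ?thesis by blast
qed

section \<open>Additive maps preserving many points\<close>

text \<open>For \<open>a\<close> outside \<open>E\<close> the elements 1 and \<open>a\<close> are
  independent over \<open>E\<close>, so pairs from \<open>E\<close> inject into the field.\<close>

lemma square_card_proper_subfield:
  fixes E :: "'a::{field,finite} set"
  assumes "is_subfield E" "E \<noteq> UNIV"
  shows "card E ^ 2 \<le> card (UNIV :: 'a set)"
proof -
  obtain a where a: "a \<notin> E" using assms(2) by blast
  have diff: "x - y \<in> E" if "x \<in> E" "y \<in> E" for x y
    using assms(1) that unfolding is_subfield_def by (metis diff_conv_add_uminus)
  have "inj_on (\<lambda>(x, y). x + y * a) (E \<times> E)"
  proof (rule inj_onI, clarify)
    fix x y x' y' assume E: "x \<in> E" "y \<in> E" "x' \<in> E" "y' \<in> E" and eq: "x + y * a = x' + y' * a"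
    have *: "(y - y') * a = x' - x" using eq by (simp add: algebra_simps)
    have "y = y'"
    proof (rule ccontr)
      assume "y \<noteq> y'"
      hence "a = (x' - x) * inverse (y - y')" using * by (simp add: field_simps)
      moreover have "\<dots> \<in> E" using E diff assms(1) unfolding is_subfield_def by blast
      ultimately show False using a by simp
    qed
    thus "x = x' \<and> y = y'" using eq by simp
  qed
  hence "card (E \<times> E) \<le> card (UNIV :: 'a set)" by (rule card_inj_on_le) auto
  thus ?thesis by (simp add: card_cartesian_product power2_eq_square)
qed

text \<open>After normalising three preserved points, the map becomes \<open>(x, y) \<mapsto> (\<alpha> x, \<alpha> y)\<close>, and the
  preserved points are those whose slope lies in the subfield on which \<open>\<alpha>\<close> is multiplicative.\<close>

lemma additive_preserving_points_in_GammaL: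
  fixes \<phi> :: "'a::{field,finite} \<times> 'a \<Rightarrow> 'a \<times> 'a" and S :: "('a \<times> 'a) set set"
  assumes bij: "bij \<phi>" and add: "\<And>x y. \<phi> (x + y) = \<phi> x + \<phi> y"
    and S: "\<And>P. P \<in> S \<Longrightarrow> \<exists>v w. v \<noteq> 0 \<and> P = proj_pt v \<and> \<phi> ` P = proj_pt w"
    and card: "card S \<ge> 3" "(card S - 1) ^ 2 > card (UNIV :: 'a set)"
  shows "\<phi> \<in> GammaL"
proof -
  have \<phi>0: "\<phi> 0 = 0" using add[of 0 0] by simp
  have inj: "\<phi> x = \<phi> y \<longleftrightarrow> x = y" for x y using bij by (simp add: bij_is_inj inj_eq)
  have point: "\<phi> ` proj_pt v = proj_pt (\<phi> v)" if vS: "proj_pt v \<in> S" and "v \<noteq> 0" for v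
  proof -
    obtain w where w: "\<phi> ` proj_pt v = proj_pt w" using S[OF vS] by blast
    have "\<phi> v \<in> \<phi> ` proj_pt v" by (metis imageI proj_pt_iff smul.scale_one)
    hence "\<exists>a. \<phi> v = smul a w" using w proj_pt_iff by blast
    moreover have "\<phi> v \<noteq> 0" using inj[of v 0] \<open>v \<noteq> 0\<close> \<phi>0 by simp
    ultimately show ?thesis using w proj_pt_eqI by metis
  qed
  obtain P0 P1 P2 where P: "{P0, P1, P2} \<subseteq> S" and dist: "P0 \<noteq> P1" "P0 \<noteq> P2" "P1 \<noteq> P2"
  proof -
    obtain T where "T \<subseteq> S" "card T = 3" using card(1) by (meson obtain_subset_with_card_n)
    thus ?thesis using that unfolding card_3_iff by blast
  qed
  obtain u0 where u0: "u0 \<noteq> 0" "P0 = proj_pt u0" using S[of P0] P by blast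
  obtain v0 where v0: "v0 \<noteq> 0" "P1 = proj_pt v0" using S[of P1] P by blast
  obtain w0 where w0: "w0 \<noteq> 0" "P2 = proj_pt w0" using S[of P2] P by blast
  obtain a b where ab: "w0 = smul a u0 + smul b v0"
    using proj_pt_decompose[OF u0(1) v0(1), of w0] dist(1) u0(2) v0(2) by auto
  \<comment> \<open>Rescaling makes the three points a frame spanned by \<open>u\<close>,
    \<open>v\<close> and \<open>u + v\<close>.\<close>
  define u v where "u = smul a u0" and "v = smul b v0"
  have "a \<noteq> 0" using ab w0 v0 dist(3) proj_pt_eqI[OF w0(1), of b v0] by auto
  have "b \<noteq> 0" using ab w0 u0 dist(2) proj_pt_eqI[OF w0(1), of a u0] by auto
  have u: "u \<noteq> 0" "P0 = proj_pt u" using u0 \<open>a \<noteq> 0\<close> proj_pt_eqI[of u a u0] u_def by auto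
  have v: "v \<noteq> 0" "P1 = proj_pt v" using v0 \<open>b \<noteq> 0\<close> proj_pt_eqI[of v b v0] v_def by auto
  have w: "w0 = u + v" using ab u_def v_def by simp
  define u' v' where "u' = \<phi> u" and "v' = \<phi> v"
  have u': "u' \<noteq> 0" using u inj[of u 0] \<phi>0 u'_def by simp
  have v': "v' \<noteq> 0" using v inj[of v 0] \<phi>0 v'_def by simp
  have imu: "\<phi> ` proj_pt u = proj_pt u'" and imv: "\<phi> ` proj_pt v = proj_pt v'"
    using point u v P u'_def v'_def by auto
  have ne': "proj_pt u' \<noteq> proj_pt v'"
    using dist u v imu imv bij by (metis bij_is_inj inj_image_eq_iff)
  have indep: "x = x' \<and> y = y'" if eq: "smul x u' + smul y v' = smul x' u' + smul y' v'" for x y x' y'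
  proof -
    have e: "smul (x - x') u' = smul (y' - y) v'"
      using eq by (simp add: smul.scale_left_diff_distrib algebra_simps)
    have "x = x'"
    proof (rule ccontr)
      assume "x \<noteq> x'"
      hence "u' = smul (inverse (x - x')) (smul (y' - y) v')"
        using e by (metis right_minus_eq smul_inverse_smul(1))
      hence "u' = smul (inverse (x - x') * (y' - y)) v'" by simp
      thus False using proj_pt_eqI[OF u'] ne' by blast
    qed
    thus ?thesis using e v' by simp
  qed
  have "\<exists>y. \<phi> (smul x u) = smul y u'" for x
  proof -
    have "\<phi> (smul x u) \<in> \<phi> ` proj_pt u" using proj_pt_iff by blast
    thus ?thesis unfolding imu proj_pt_iff .
  qed
  then obtain \<alpha> where \<alpha>: "\<And>x. \<phi> (smul x u) = smul (\<alpha> x) u'" by metis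
  have "\<exists>y. \<phi> (smul x v) = smul y v'" for x
  proof -
    have "\<phi> (smul x v) \<in> \<phi> ` proj_pt v" using proj_pt_iff by blast
    thus ?thesis unfolding imv proj_pt_iff .
  qed
  then obtain \<beta> where \<beta>: "\<And>x. \<phi> (smul x v) = smul (\<beta> x) v'" by metis
  \<comment> \<open>The third preserved point, through \<open>u + v\<close>, forces the two
    coordinate maps to agree.\<close>
  have "\<alpha> x = \<beta> x" for x
  proof -
    have "\<phi> ` proj_pt (u + v) = proj_pt (u' + v')"
      using point[of "u + v"] P w w0 add u'_def v'_def by simp
    moreover have "\<phi> (smul x (u + v)) \<in> \<phi> ` proj_pt (u + v)" using proj_pt_iff by blast
    ultimately obtain c where "\<phi> (smul x (u + v)) = smul c (u' + v')"
      using proj_pt_iff[of _ "u' + v'"] by auto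
    hence "smul (\<alpha> x) u' + smul (\<beta> x) v' = smul c u' + smul c v'"
      by (simp add: smul.scale_right_distrib add \<alpha> \<beta>)
    thus ?thesis using indep by metis
  qed
  hence \<beta>: "\<phi> (smul x v) = smul (\<alpha> x) v'" for x using \<beta> by simp
  have \<alpha>1: "\<alpha> 1 = 1" using \<alpha>[of 1] indep[of "\<alpha> 1" 0 1 0] by (simp add: u'_def)
  have \<alpha>_add: "\<alpha> (x + y) = \<alpha> x + \<alpha> y" for x y
    using indep[of "\<alpha> (x + y)" 0 "\<alpha> x + \<alpha> y" 0] \<alpha>[of "x + y"]
    by (simp add: smul.scale_left_distrib add \<alpha>)
  have \<alpha>0: "\<alpha> 0 = 0" using \<alpha>_add[of 0 0] by (metis add.right_neutral add_left_cancel)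
  have \<alpha>_minus: "\<alpha> (- x) = - \<alpha> x" for x using \<alpha>_add[of x "- x"] \<alpha>0 by (metis add.right_inverse minus_unique)
  have "inj \<alpha>"
  proof (rule injI)
    fix x y assume "\<alpha> x = \<alpha> y"
    hence "smul x u = smul y u" using \<alpha> inj by metis
    thus "x = y" using u by simp
  qed
  hence bij_\<alpha>: "bij \<alpha>" by (simp add: finite_UNIV_inj_surj bij_def)
  have \<alpha>_eq0: "\<alpha> x = 0 \<longleftrightarrow> x = 0" for x using \<open>inj \<alpha>\<close> \<alpha>0 by (metis injD)
  \<comment> \<open>Quantifying over all \<open>x\<close> is what makes this set closed under
    products and inverses.\<close>
  define E where "E = {m. \<forall>x. \<alpha> (x * m) = \<alpha> x * \<alpha> m}"
  have "is_subfield E"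
    unfolding is_subfield_def
  proof (intro conjI ballI)
    show "0 \<in> E" "1 \<in> E" by (auto simp: E_def \<alpha>0 \<alpha>1)
    fix m n assume mn: "m \<in> E"
    show "- m \<in> E" using mn by (simp add: E_def \<alpha>_minus)
    show "inverse m \<in> E"
    proof (cases "m = 0")
      case False
      have "\<alpha> (x * inverse m * m) = \<alpha> (x * inverse m) * \<alpha> m" for x
        using mn unfolding E_def by blast
      moreover have "x * inverse m * m = x" for x using False by (simp add: mult.assoc)
      ultimately have *: "\<alpha> (x * inverse m) = \<alpha> x / \<alpha> m" for x
        using False \<alpha>_eq0[of m] by (metis nonzero_eq_divide_eq)
      have "\<alpha> (inverse m) = 1 / \<alpha> m" using *[of 1] \<alpha>1 by simp
      thus ?thesis using * by (simp add: E_def)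
    qed (simp add: E_def \<alpha>0)
    assume n: "n \<in> E"
    show "m + n \<in> E" using mn n by (simp add: E_def distrib_left \<alpha>_add)
    show "m * n \<in> E" using mn n by (simp add: E_def flip: mult.assoc)
  qed
  \<comment> \<open>\<open>P1\<close> is the point at infinity of the frame and has no slope; this
    is the 1 in \<open>card S - 1\<close>.\<close>
  have "S - {P1} \<subseteq> (\<lambda>m. proj_pt (u + smul m v)) ` E"
  proof
    fix P assume P: "P \<in> S - {P1}"
    then obtain w where w: "w \<noteq> 0" "P = proj_pt w" using S by blast
    obtain c d where cd: "w = smul c u + smul d v"
      using proj_pt_decompose[OF u(1) v(1), of w] dist(1) u(2) v(2) by auto
    have "c \<noteq> 0" using P w v proj_pt_eqI[OF w(1), of d v] cd by auto
    hence weq: "w = smul c (u + smul (d / c) v)" using cd by (simp add: smul.scale_right_distrib)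
    define m where "m = d / c"
    have nz: "u + smul m v \<noteq> 0" using w weq m_def by auto
    have Pm: "P = proj_pt (u + smul m v)" using w proj_pt_eqI[OF w(1) weq] m_def by simp
    have im: "\<phi> ` proj_pt (u + smul m v) = proj_pt (u' + smul (\<alpha> m) v')"
      using point[OF _ nz] P Pm by (simp add: add \<beta> u'_def)
    \<comment> \<open>The point of slope \<open>m\<close> goes to the point of slope
      \<open>\<alpha> m\<close>, so the image of each multiple of \<open>u + smul m v\<close> stays
      on the latter; comparing coordinates gives multiplicativity.\<close>
    have "m \<in> E"
      unfolding E_def
    proof safe
      fix x
      have "\<phi> (smul x (u + smul m v)) \<in> \<phi> ` proj_pt (u + smul m v)" using proj_pt_iff by blast
      then obtain e where "\<phi> (smul x (u + smul m v)) = smul e (u' + smul (\<alpha> m) v')"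
        unfolding im proj_pt_iff by blast
      hence "smul (\<alpha> x) u' + smul (\<alpha> (x * m)) v' = smul e u' + smul (e * \<alpha> m) v'"
        by (simp add: smul.scale_right_distrib add \<alpha> \<beta>)
      thus "\<alpha> (x * m) = \<alpha> x * \<alpha> m" using indep by metis
    qed
    thus "P \<in> (\<lambda>m. proj_pt (u + smul m v)) ` E" using Pm by blast
  qed
  hence "card (S - {P1}) \<le> card E" by (rule surj_card_le[rotated]) simp
  moreover have "P1 \<in> S" using P by blast
  ultimately have "card S - 1 \<le> card E" by simp
  hence "card E ^ 2 > card (UNIV :: 'a set)" using card(2) by (meson less_le_trans power_mono zero_le)
  hence "E = UNIV" using square_card_proper_subfield[OF \<open>is_subfield E\<close>] by force
  hence mult: "\<alpha> (x * y) = \<alpha> x * \<alpha> y" for x y unfolding E_def by blast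
  have "\<phi> (smul x w) = smul (\<alpha> x) (\<phi> w)" for x w
  proof -
    obtain c d where cd: "w = smul c u + smul d v"
      using proj_pt_decompose[OF u(1) v(1), of w] dist(1) u(2) v(2) by auto
    show ?thesis unfolding cd by (simp add: smul.scale_right_distrib add \<alpha> \<beta> mult)
  qed
  thus ?thesis unfolding GammaL_def using bij bij_\<alpha> add \<alpha>_add mult by blast
qed

section \<open>Counting orbits\<close>

context
  fixes A :: "'b set" and G :: "'k set" and act :: "'k \<Rightarrow> 'b \<Rightarrow> 'b" and f :: "'b \<Rightarrow> 'c"
  assumes fin: "finite A"
    and act: "\<And>a x. a \<in> G \<Longrightarrow> x \<in> A \<Longrightarrow> act a x \<in> A" "\<And>a x. a \<in> G \<Longrightarrow> x \<in> A \<Longrightarrow> f (act a x) = f x"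
    and inj: "\<And>x. x \<in> A \<Longrightarrow> inj_on (\<lambda>a. act a x) G"
begin

lemma card_orbit: "x \<in> A \<Longrightarrow> card ((\<lambda>a. act a x) ` G) = card G"
  and orbit_subset_fibre: "x \<in> A \<Longrightarrow> (\<lambda>a. act a x) ` G \<subseteq> {y \<in> A. f y = f x}"
  using act inj by (auto simp: card_image)

lemma card_le_card_fibre: "x \<in> A \<Longrightarrow> card G \<le> card {y \<in> A. f y = f x}"
  using card_mono[OF _ orbit_subset_fibre[of x]] card_orbit[of x] fin by simp

lemma card_eq_sum_fibres: "card A = (\<Sum>z\<in>f ` A. card {y \<in> A. f y = z})"
  using sum.image_gen[OF fin, of "\<lambda>_. 1::nat" f] by simp

text \<open>Every fibre contains a set of size \<open>card G\<close>. In the applications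
  \<open>G\<close> consists of the nonzero elements of K, acting on the vectors of a subspace, on
  the arguments x of f(x)/x, or on the multipliers of a graph.\<close>

lemma card_image_mult_le: "card (f ` A) * card G \<le> card A"
proof -
  have "(\<Sum>z\<in>f ` A. card G) \<le> (\<Sum>z\<in>f ` A. card {y \<in> A. f y = z})"
    by (rule sum_mono) (use card_le_card_fibre in auto)
  thus ?thesis using card_eq_sum_fibres by simp
qed

text \<open>When the count is attained no fibre can exceed one orbit, since a further element would
  make the sum over the fibres strictly too large.\<close>

lemma fibre_eq_orbit:
  assumes eq: "card (f ` A) * card G = card A" and x: "x \<in> A" and y: "y \<in> A" "f y = f x"
  shows "\<exists>a\<in>G. y = act a x"
proof (rule ccontr)
  assume "\<not> ?thesis"
  hence "(\<lambda>a. act a x) ` G \<subset> {y \<in> A. f y = f x}" using y orbit_subset_fibre[OF x] by blast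
  from psubset_card_mono[OF _ this] have "card G < card {y \<in> A. f y = f x}"
    using fin card_orbit[OF x] by simp
  hence "(\<Sum>z\<in>f ` A. card G) < (\<Sum>z\<in>f ` A. card {y \<in> A. f y = z})"
    using card_le_card_fibre x fin by (intro sum_strict_mono_ex1) auto
  thus False using card_eq_sum_fibres eq by simp
qed

end

section \<open>Scattered subspaces\<close>

lemma K_subspace_diff:
  assumes "is_subfield K" "K_subspace K U" "u \<in> U" "v \<in> U"
  shows "u - v \<in> U"
proof -
  have "smul (- 1) v \<in> U" using assms unfolding is_subfield_def K_subspace_def by blast
  hence "u + smul (- 1) v \<in> U" using assms unfolding K_subspace_def by blast
  thus ?thesis by simp
qed

text \<open>Rank t is encoded by cardinality and scatteredness by the scalars that keep a nonzero
  vector inside \<open>U\<close>. Both are basis-free and pass easily through linear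
  bijections.\<close>

definition scattered_space :: "'a::{field,finite} set \<Rightarrow> ('a \<times> 'a) set \<Rightarrow> bool" where
  "scattered_space K U \<longleftrightarrow> K_subspace K U \<and> card U = card (UNIV :: 'a set) \<and>
     (\<forall>u\<in>U. \<forall>a. u \<noteq> 0 \<longrightarrow> smul a u \<in> U \<longrightarrow> a \<in> K)"

text \<open>The N points of finite slope and the vertical one are all distinct. This serves twice:
  to bound the size of a subspace and to find a point off L.\<close>

lemma card_all_points:
  fixes L :: "('a::{field,finite} \<times> 'a) set set"
  assumes "\<And>w. w \<noteq> 0 \<Longrightarrow> proj_pt w \<in> L"
  shows "card (UNIV :: 'a set) < card L"
proof -
  have ne: "(1, m) \<noteq> (0 :: 'a \<times> 'a)" for m by (simp add: prod_eq_iff)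
  have "inj (\<lambda>m :: 'a. proj_pt (1, m))"
    using ne by (auto intro!: injI simp: proj_pt_eq_iff smul_def)
  hence "card (UNIV :: 'a set) = card (range (\<lambda>m :: 'a. proj_pt (1, m)))" by (simp add: card_image)
  also have "\<dots> < card L"
  proof (rule psubset_card_mono)
    have "proj_pt (0, 1) \<notin> range (\<lambda>m :: 'a. proj_pt (1, m))"
      using ne by (auto simp: eq_commute[of "proj_pt (0, 1)"] proj_pt_eq_iff smul_def)
    moreover have "proj_pt (0, 1) \<in> L" by (rule assms) (simp add: prod_eq_iff)
    ultimately show "range (\<lambda>m :: 'a. proj_pt (1, m)) \<subset> L" using assms ne by blast
  qed simp
  finally show ?thesis .
qed

text \<open>The determinant with \<open>w\<close> takes at most N values, so two vectors of
  \<open>U\<close> collide, and their difference spans the point of \<open>w\<close>.\<close>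

lemma lin_set_large_subspace:
  fixes U :: "('a::{field,finite} \<times> 'a) set"
  assumes "is_subfield K" "K_subspace K U" "card U > card (UNIV :: 'a set)" "w \<noteq> 0"
  shows "proj_pt w \<in> lin_set U"
proof -
  have "\<not> inj_on (\<lambda>v. fst w * snd v - snd w * fst v) U"
    using card_inj_on_le[of _ U "UNIV :: 'a set"] assms(3) by fastforce
  then obtain u v where uv: "u \<in> U" "v \<in> U" "u \<noteq> v"
    and eq: "fst w * snd u - snd w * fst u = fst w * snd v - snd w * fst v"
    unfolding inj_on_def by blast
  have "fst w * snd (u - v) = snd w * fst (u - v)" using eq by (simp add: algebra_simps)
  hence "proj_pt (u - v) = proj_pt w" using uv assms(4) by (intro proj_pt_eqI_det) auto
  moreover have "u - v \<in> U - {0}" using K_subspace_diff[OF assms(1,2) uv(1,2)] uv(3) by simp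
  ultimately show ?thesis unfolding lin_set_def by blast
qed

text \<open>Counting K-multiples bounds the size of \<open>U\<close> below by N. The linear set is
  too small to contain all points, so \<open>lin_set_large_subspace\<close> bounds it above by N.
  Equality in the first count then says that each point meets \<open>U\<close> in the K-multiples of
  a single vector.\<close>

lemma scattered_spaceI:
  fixes U :: "('a::{field,finite} \<times> 'a) set"
  assumes K: "is_subfield K" and U: "K_subspace K U"
    and card: "card (lin_set U) * (card K - 1) + 1 = card (UNIV :: 'a set)"
  shows "scattered_space K U"
proof -
  have lin: "lin_set U = proj_pt ` (U - {0})" unfolding lin_set_def by blast
  have cK: "card (K - {0}) = card K - 1" using K by (simp add: is_subfield_def)
  have act: "smul a u \<in> U - {0}" "proj_pt (smul a u) = proj_pt u"
    if "a \<in> K - {0}" "u \<in> U - {0}" for a u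
    using that U proj_pt_eqI[of "smul a u" a u] by (auto simp: K_subspace_def)
  have inj: "inj_on (\<lambda>a. smul a u) (K - {0})" if "u \<in> U - {0}" for u
    using that by (auto intro: inj_onI)
  have "card (lin_set U) * (card K - 1) \<le> card (U - {0})"
    unfolding lin cK[symmetric] by (rule card_image_mult_le[where act = smul]) (use act inj in auto)
  moreover have "0 \<in> U" using U by (simp add: K_subspace_def)
  hence cU: "card (U - {0}) + 1 = card U" using card_Suc_Diff1[of U 0] by simp
  ultimately have ge: "card (UNIV :: 'a set) \<le> card U" using card by linarith
  have "card (lin_set U) < card (UNIV :: 'a set)"
  proof (cases "card K - 1")
    \<comment> \<open>This case is void: K contains 0 and 1, so truncated subtraction cannot give
      0.\<close>
    case 0
    thus ?thesis using card \<open>0 \<in> U\<close> K card_mono[of K "{0, 1}"] by (auto simp: is_subfield_def)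
  next
    case (Suc n)
    thus ?thesis using card by simp
  qed
  hence "\<not> card (UNIV :: 'a set) < card U"
    using card_all_points lin_set_large_subspace[OF K U] by (meson less_asym)
  hence cU': "card U = card (UNIV :: 'a set)" using ge by simp
  have "a \<in> K" if u: "u \<in> U" "u \<noteq> 0" and au: "smul a u \<in> U" for u a
  proof (cases "a = 0")
    case False
    have "card (proj_pt ` (U - {0})) * card (K - {0}) = card (U - {0})"
      using card cU cU' cK lin by simp
    hence "\<exists>b\<in>K - {0}. smul a u = smul b u"
      using proj_pt_eqI[of "smul a u" a u] False u au act inj
      by (intro fibre_eq_orbit[where f = proj_pt and A = "U - {0}" and G = "K - {0}" and act = smul]) auto
    thus ?thesis using u by auto
  qed (use K in \<open>simp add: is_subfield_def\<close>)
  thus ?thesis unfolding scattered_space_def using U cU' by blast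
qed

section \<open>Graphs of K-linear maps\<close>

definition K_linear :: "'a::field set \<Rightarrow> ('a \<Rightarrow> 'a) \<Rightarrow> bool" where
  "K_linear K F \<longleftrightarrow> (\<forall>x y. F (x + y) = F x + F y) \<and> (\<forall>a\<in>K. \<forall>x. F (a * x) = a * F x)"

lemma K_linear_zero: "K_linear K F \<Longrightarrow> F 0 = 0"
  unfolding K_linear_def by (metis add.right_neutral add_left_cancel)

text \<open>The first coordinate has trivial kernel on \<open>U\<close>, hence is injective there,
  and the size N of \<open>U\<close> makes it onto.\<close>

lemma scattered_space_is_graph:
  fixes U :: "('a::{field,finite} \<times> 'a) set"
  assumes K: "is_subfield K" and U: "scattered_space K U"
    and vert: "\<And>u. u \<in> U \<Longrightarrow> fst u = 0 \<Longrightarrow> u = 0"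
  shows "\<exists>F. K_linear K F \<and> U = range (\<lambda>x. (x, F x))"
proof -
  have sub: "K_subspace K U" using U by (simp add: scattered_space_def)
  have inj: "inj_on fst U"
  proof (rule inj_onI)
    fix u v assume "u \<in> U" "v \<in> U" "fst u = fst v"
    thus "u = v" using vert[of "u - v"] K_subspace_diff[OF K sub] by simp
  qed
  hence surj: "fst ` U = UNIV"
    using U by (intro card_subset_eq) (auto simp: card_image scattered_space_def)
  define F where "F x = snd (inv_into U fst x)" for x
  have F: "(x, F x) \<in> U" for x
  proof -
    have "x \<in> fst ` U" using surj by simp
    hence "inv_into U fst x \<in> U" "fst (inv_into U fst x) = x"
      by (auto simp: inv_into_into f_inv_into_f)
    thus ?thesis unfolding F_def by (metis prod.collapse)
  qed
  have uniq: "y = F x" if "(x, y) \<in> U" for x y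
    using inj_onD[OF inj, of "(x, y)" "(x, F x)"] F that by simp
  have "K_linear K F"
    unfolding K_linear_def
  proof (intro conjI ballI allI)
    fix x y
    have "(x, F x) + (y, F y) \<in> U" using F sub unfolding K_subspace_def by blast
    thus "F (x + y) = F x + F y" using uniq by simp
  next
    fix a x assume "a \<in> K"
    hence "smul a (x, F x) \<in> U" using F sub unfolding K_subspace_def by blast
    thus "F (a * x) = a * F x" using uniq by (simp add: smul_def)
  qed
  moreover have "U = range (\<lambda>x. (x, F x))" using F uniq by auto
  ultimately show ?thesis by blast
qed

section \<open>Linearized polynomials\<close>

text \<open>Multiplication by a nonzero \<open>x\<close> permutes the nonzero elements of K;
  comparing their products gives x^(q - 1) = 1.\<close>

lemma subfield_power_card:
  fixes K :: "'a::{field,finite} set"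
  assumes K: "is_subfield K" and x: "x \<in> K"
  shows "x ^ card K = x"
proof (cases "x = 0")
  case True
  moreover have "card K > 0" using x by (auto simp: card_gt_0_iff)
  ultimately show ?thesis by simp
next
  case False
  have "inj_on ((*) x) (K - {0})" using False by (auto intro: inj_onI)
  moreover have "(*) x ` (K - {0}) \<subseteq> K - {0}" using K x False unfolding is_subfield_def by auto
  ultimately have im: "(*) x ` (K - {0}) = K - {0}" by (intro endo_inj_surj) auto
  have "\<Prod>(K - {0}) = (\<Prod>y\<in>K - {0}. x * y)"
    using prod.reindex[OF \<open>inj_on ((*) x) (K - {0})\<close>, of "\<lambda>y. y"] im by (simp add: comp_def)
  also have "\<dots> = x ^ card (K - {0}) * \<Prod>(K - {0})" by (simp add: prod.distrib)
  finally have "x ^ card (K - {0}) = 1" by simp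
  hence "x ^ Suc (card (K - {0})) = x" by simp
  moreover have "Suc (card (K - {0})) = card K"
    using K by (intro card_Suc_Diff1) (auto simp: is_subfield_def)
  ultimately show ?thesis by metis
qed

text \<open>As q is a power of the characteristic, these powers are additive, and they fix K
  elementwise by \<open>subfield_power_card\<close>.\<close>

lemma K_linear_power_card:
  fixes K :: "'a::{field,finite} set"
  assumes K: "is_subfield K" and q: "primepow (card K)" and N: "card (UNIV :: 'a set) = card K ^ t"
  shows "K_linear K (\<lambda>x. x ^ (card K ^ i))"
proof -
  obtain p n where p: "prime p" "card K = p ^ n" using q by (auto simp: primepow_def)
  have "CHAR('a) > 0" by (rule finite_imp_CHAR_pos) simp
  hence pc: "prime CHAR('a)" by (rule prime_CHAR_semidom)
  \<comment> \<open>Adding 1 permutes the field, so N times 1 vanishes. This identifies the prime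
    below q with the characteristic.\<close>
  have "(\<Sum>x\<in>UNIV. x) = (\<Sum>x\<in>UNIV. x + 1 :: 'a)"
    by (rule sum.reindex_bij_witness[of _ "\<lambda>x. x + 1" "\<lambda>x. x - 1"]) auto
  hence "of_nat (card (UNIV :: 'a set)) = (0 :: 'a)" by (simp add: sum.distrib)
  hence "of_nat p = (0 :: 'a)" using N p by (simp flip: power_mult)
  hence "CHAR('a) dvd p" by (simp add: of_nat_eq_0_iff_char_dvd)
  hence "CHAR('a) = p" using pc p primes_dvd_imp_eq by blast
  hence "card K ^ i = CHAR('a) ^ (n * i)" using p by (simp add: power_mult)
  from freshmans_dream'[OF pc this] have "(x + y) ^ (card K ^ i) = x ^ (card K ^ i) + y ^ (card K ^ i)" for x y :: 'a .
  moreover have "a ^ (card K ^ i) = a" if "a \<in> K" for a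
    using subfield_power_card[OF K that] by (induction i) (simp_all add: power_mult)
  ultimately show ?thesis by (simp add: K_linear_def power_mult_distrib)
qed

lemma K_linear_sum:
  assumes "K_linear K F"
  shows "F (\<Sum>i\<in>I. g i) = (\<Sum>i\<in>I. F (g i))"
  using assms K_linear_zero[OF assms]
  by (induction I rule: infinite_finite_induct) (simp_all add: K_linear_def)

lemma K_linear_eqI:
  assumes F: "K_linear K F" and G: "K_linear K G" and "\<And>i. i \<in> I \<Longrightarrow> F (e i) = G (e i)"
    and span: "\<exists>a. (\<forall>i\<in>I. a i \<in> K) \<and> x = (\<Sum>i\<in>I. a i * e i)"
  shows "F x = G x"
proof -
  obtain a where a: "\<And>i. i \<in> I \<Longrightarrow> a i \<in> K" "x = (\<Sum>i\<in>I. a i * e i)" using span by blast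
  have "F x = (\<Sum>i\<in>I. a i * F (e i))" "G x = (\<Sum>i\<in>I. a i * G (e i))"
    unfolding a(2) K_linear_sum[OF F] K_linear_sum[OF G]
    using F G a(1) by (auto simp: K_linear_def intro!: sum.cong)
  thus ?thesis using assms(3) by simp
qed

text \<open>Evaluation at a spanning family of size \<open>t\<close> is an injective, hence bijective, map from
  the coefficient vectors of length \<open>t\<close> to the value vectors of length \<open>t\<close>.\<close>

lemma K_linear_is_linearized:
  fixes K :: "'a::{field,finite} set"
  assumes K: "is_subfield K" and q: "primepow (card K)" and N: "card (UNIV :: 'a set) = card K ^ t"
    and t: "t > 0" and span: "\<And>x. \<exists>a. (\<forall>i\<in>{..<t}. a i \<in> K) \<and> x = (\<Sum>i<t. a i * e i)"
    and F: "K_linear K F"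
  shows "\<exists>f. linearized K f \<and> poly f = F"
proof -
  let ?q = "card K"
  have q1: "?q > 1" using primepow_gt_Suc_0[OF q] by simp
  define P where "P a = (\<Sum>i<t. monom (a i) (?q ^ i))" for a :: "nat \<Rightarrow> 'a"
  have poly: "poly (P a) x = (\<Sum>i<t. a i * x ^ (?q ^ i))" for a x
    by (simp add: P_def poly_sum poly_monom)
  have lin: "K_linear K (poly (P a))" for a
    unfolding K_linear_def
  proof (intro conjI ballI allI)
    note pow = K_linear_power_card[OF K q N, unfolded K_linear_def]
    show "poly (P a) (x + y) = poly (P a) x + poly (P a) y" for x y
      by (simp add: poly pow distrib_left sum.distrib)
    show "poly (P a) (b * x) = b * poly (P a) x" if b: "b \<in> K" for b x
    proof -
      have "(b * x) ^ (?q ^ i) = b * x ^ (?q ^ i)" for i using pow b by blast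
      thus ?thesis by (simp add: poly sum_distrib_left mult.left_commute)
    qed
  qed
  \<comment> \<open>A polynomial of degree below N is determined by its values, which yields
    injectivity of \<open>ev\<close>.\<close>
  have deg: "degree (P a) < card (UNIV :: 'a set)" for a
  proof -
    have "degree (P a) \<le> ?q ^ (t - 1)"
      unfolding P_def using q1
      by (intro degree_sum_le) (auto intro!: order.trans[OF degree_monom_le] power_increasing)
    also have "\<dots> < ?q ^ t" using q1 t by (intro power_strict_increasing) auto
    finally show ?thesis using N by simp
  qed
  \<comment> \<open>The exponents q^i are distinct because q > 1, so the coefficients can be read
    off.\<close>
  have coeff: "coeff (P a) (?q ^ i) = a i" if "i < t" for a i
  proof -
    have "coeff (P a) (?q ^ i) = (\<Sum>j<t. if j = i then a j else 0)"
      using q1 by (simp add: P_def coeff_sum coeff_monom power_inject_exp)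
    thus ?thesis using that by simp
  qed
  \<comment> \<open>Restricting keeps the values in a finite set of extensional functions, where
    injective implies onto.\<close>
  define ev where "ev a = restrict (\<lambda>j. poly (P a) (e j)) {..<t}" for a
  have "inj_on ev ({..<t} \<rightarrow>\<^sub>E UNIV)"
  proof (rule inj_onI)
    fix a b assume ab: "a \<in> {..<t} \<rightarrow>\<^sub>E UNIV" "b \<in> {..<t} \<rightarrow>\<^sub>E UNIV" and "ev a = ev b"
    hence "poly (P a) (e j) = poly (P b) (e j)" if "j \<in> {..<t}" for j
      using that unfolding ev_def by (metis restrict_apply')
    hence "poly (P a) x = poly (P b) x" for x
      using K_linear_eqI[OF lin lin _ span] by blast
    hence "P a = P b" using deg by (intro poly_eqI_degree[of UNIV]) auto
    hence "a i = b i" if "i < t" for i using coeff that by metis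
    thus "a = b" using PiE_ext[OF ab] by simp
  qed
  moreover have "ev ` ({..<t} \<rightarrow>\<^sub>E UNIV) \<subseteq> {..<t} \<rightarrow>\<^sub>E UNIV"
    by (intro image_subsetI) (simp add: ev_def)
  ultimately have "ev ` ({..<t} \<rightarrow>\<^sub>E UNIV) = {..<t} \<rightarrow>\<^sub>E UNIV"
    by (intro endo_inj_surj finite_PiE) auto
  moreover have "restrict (\<lambda>j. F (e j)) {..<t} \<in> {..<t} \<rightarrow>\<^sub>E UNIV" by simp
  ultimately have "restrict (\<lambda>j. F (e j)) {..<t} \<in> ev ` ({..<t} \<rightarrow>\<^sub>E UNIV)" by (simp only:)
  then obtain a where a: "restrict (\<lambda>j. F (e j)) {..<t} = ev a" by blast
  hence "poly (P a) (e j) = F (e j)" if "j \<in> {..<t}" for j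
    using that unfolding ev_def by (metis restrict_apply')
  hence "poly (P a) = F" using K_linear_eqI[OF lin F _ span] by blast
  moreover have "linearized K (P a)"
    \<comment> \<open>The sum in \<open>linearized\<close> includes its upper index, hence
      \<open>t - 1\<close>.\<close>
    unfolding linearized_def P_def using t by (intro exI[of _ "t - 1"] exI[of _ a] sum.cong) auto
  ultimately show ?thesis by blast
qed

section \<open>The spread of a scattered polynomial\<close>

text \<open>Trivial intersection makes addition injective on pairs, and N^2 distinct sums fill the
  plane.\<close>

lemma complementary_subgroups:
  fixes V W :: "('a::{field,finite} \<times> 'a) set"
  assumes V: "\<And>x y. x \<in> V \<Longrightarrow> y \<in> V \<Longrightarrow> x - y \<in> V" and W: "\<And>x y. x \<in> W \<Longrightarrow> y \<in> W \<Longrightarrow> x - y \<in> W"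
    and Int: "\<And>x. x \<in> V \<Longrightarrow> x \<in> W \<Longrightarrow> x = 0"
    and card: "card V = card (UNIV :: 'a set)" "card W = card (UNIV :: 'a set)"
  shows "\<exists>v\<in>V. \<exists>w\<in>W. x = v + w"
proof -
  have "inj_on (\<lambda>(v, w). v + w) (V \<times> W)"
  proof (rule inj_onI, clarify)
    fix v w v' w' assume VW: "v \<in> V" "w \<in> W" "v' \<in> V" "w' \<in> W" and "v + w = v' + w'"
    hence eq: "v - v' = w' - w" by (simp add: algebra_simps)
    have "v - v' = 0" using V[OF VW(1,3)] W[OF VW(4,2)] Int eq by metis
    thus "v = v' \<and> w = w'" using eq by simp
  qed
  hence "card ((\<lambda>(v, w). v + w) ` (V \<times> W)) = card (UNIV :: ('a \<times> 'a) set)"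
    using card by (simp add: card_image card_cartesian_product flip: UNIV_Times_UNIV)
  hence "(\<lambda>(v, w). v + w) ` (V \<times> W) = UNIV" by (intro card_subset_eq) auto
  hence "x \<in> (\<lambda>(v, w). v + w) ` (V \<times> W)" by simp
  thus ?thesis by auto
qed

lemma proj_pt_eq_range: "proj_pt v = range (\<lambda>a. smul a v)"
  by (auto simp: proj_pt_def)

lemma card_proj_pt:
  fixes v :: "'a::{field,finite} \<times> 'a"
  shows "v \<noteq> 0 \<Longrightarrow> card (proj_pt v) = card (UNIV :: 'a set)"
proof -
  assume "v \<noteq> 0"
  hence "inj (\<lambda>a. smul a v)" by (auto intro: injI)
  thus ?thesis by (simp add: proj_pt_eq_range card_image)
qed

lemma proj_pt_diff: "x \<in> proj_pt v \<Longrightarrow> y \<in> proj_pt v \<Longrightarrow> x - y \<in> proj_pt v"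
  unfolding proj_pt_iff using smul.scale_left_diff_distrib by metis

lemma proj_pt_zero_one: "proj_pt (0, 1) = {0} \<times> (UNIV :: 'a::field set)"
  by (auto simp: proj_pt_def smul_def)

lemma spread_cases:
  assumes "V \<in> spread_of_poly f"
  obtains (slope) m where "V = proj_pt (1, m)" "m \<notin> L_poly f"
  | (vertical) "V = proj_pt (0, 1)"
  | (graph) h where "h \<noteq> 0" "V = smul h ` U_poly f"
  using assms unfolding spread_of_poly_def proj_pt_zero_one by blast

context
  fixes K :: "'a::{field,finite} set" and f :: "'a poly"
  assumes K: "is_subfield K" and lin: "K_linear K (poly f)" and scattered: "scattered_poly K f"
begin

lemma poly_zero: "poly f 0 = 0"
  using K_linear_zero[OF lin] .

lemma scattered_poly_dependent:
  assumes "z * poly f y = y * poly f z" "y \<noteq> 0"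
  shows "\<exists>a\<in>K. z = a * y"
proof -
  obtain a b where ab: "a \<in> K" "b \<in> K" "(a, b) \<noteq> (0, 0)" "a * y + b * z = 0"
    using scattered assms unfolding scattered_poly_def by fastforce
  have "b \<noteq> 0" using ab assms by auto
  have "b * z = - a * y" using ab(4) by (simp add: eq_neg_iff_add_eq_0 add.commute)
  hence "z = (- a * inverse b) * y" using \<open>b \<noteq> 0\<close> by (simp add: field_simps)
  moreover have "- a * inverse b \<in> K" using K ab unfolding is_subfield_def by blast
  ultimately show ?thesis by blast
qed

lemma U_poly_diff: "x \<in> U_poly f \<Longrightarrow> y \<in> U_poly f \<Longrightarrow> x - y \<in> U_poly f"
proof -
  have "poly f (a - b) = poly f a - poly f b" for a b
    using lin unfolding K_linear_def by (metis diff_add_cancel eq_diff_eq)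
  thus "x \<in> U_poly f \<Longrightarrow> y \<in> U_poly f \<Longrightarrow> x - y \<in> U_poly f" by (auto simp: U_poly_def)
qed

lemma card_smul_U_poly: "h \<noteq> 0 \<Longrightarrow> card (smul h ` U_poly f) = card (UNIV :: 'a set)"
proof -
  assume h: "h \<noteq> 0"
  have "smul h ` U_poly f = range (\<lambda>x. smul h (x, poly f x))" by (auto simp: U_poly_def)
  moreover have "inj (\<lambda>x. smul h (x, poly f x))" using h by (auto intro: injI)
  ultimately show ?thesis by (simp add: card_image)
qed

text \<open>The graph is closed under scaling by K. This is what divides the number of its multiples
  by q - 1.\<close>

lemma smul_U_poly_cong:
  assumes "a \<in> K - {0}"
  shows "smul (a * h) ` U_poly f = smul h ` U_poly f"
proof -
  have sub: "smul (a * h) ` U_poly f \<subseteq> smul h ` U_poly f" if "a \<in> K" for a h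
  proof
    fix v assume "v \<in> smul (a * h) ` U_poly f"
    then obtain x where "v = smul (a * h) (x, poly f x)" by (auto simp: U_poly_def)
    also have "\<dots> = smul h (a * x, poly f (a * x))"
      using lin that by (simp add: smul_def K_linear_def)
    finally show "v \<in> smul h ` U_poly f" by (auto simp: U_poly_def)
  qed
  have "inverse a \<in> K" using K assms by (simp add: is_subfield_def)
  from sub[OF this, of "a * h"] have "smul h ` U_poly f \<subseteq> smul (a * h) ` U_poly f"
    using assms by (simp flip: mult.assoc)
  thus ?thesis using sub[of a h] assms by blast
qed

lemma component_diff:
  assumes "V \<in> spread_of_poly f" "x \<in> V" "y \<in> V"
  shows "x - y \<in> V"
  using assms(1)
proof (cases rule: spread_cases)
  case (graph h)
  obtain u v where uv: "u \<in> U_poly f" "v \<in> U_poly f" "x = smul h u" "y = smul h v"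
    using graph assms by blast
  have "x - y = smul h (u - v)" using uv by (simp add: smul.scale_right_diff_distrib)
  thus ?thesis using graph U_poly_diff uv by blast
qed (use assms proj_pt_diff in blast)+

lemma card_component:
  assumes "V \<in> spread_of_poly f"
  shows "card V = card (UNIV :: 'a set)"
  using assms
  by (cases rule: spread_cases) (simp_all add: card_proj_pt card_smul_U_poly prod_eq_iff)

text \<open>The slope of \<open>x\<close> decides the type of its component: in
  \<open>L_poly f\<close> for multiples of the graph, outside it for the other nonvertical
  components, undefined for the vertical one. Two multiples of the graph sharing \<open>x\<close>
  have multipliers that differ by a factor in K, by scatteredness.\<close>

lemma component_eqI:
  assumes V: "V \<in> spread_of_poly f" and W: "W \<in> spread_of_poly f"
    and x: "x \<noteq> 0" "x \<in> V" "x \<in> W"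
  shows "V = W"
proof -
  have point: "proj_pt x = proj_pt v" if "x \<in> proj_pt v" for v
    using that x(1) proj_pt_eqI proj_pt_iff by metis
  have fst_x: "fst x \<noteq> 0" "snd x / fst x \<in> L_poly f" if xh: "x \<in> smul h ` U_poly f" for h
  proof -
    obtain z where z: "x = smul h (z, poly f z)" using xh by (auto simp: U_poly_def)
    have "h \<noteq> 0" using z x(1) by auto
    moreover have "z \<noteq> 0" using z x(1) poly_zero by (auto simp: smul_def prod_eq_iff)
    ultimately show "fst x \<noteq> 0" "snd x / fst x \<in> L_poly f"
      using z by (auto simp: smul_def L_poly_def)
  qed
  have slope_fst: "snd x / fst x = m" if xm: "x \<in> proj_pt (1, m)" for m
  proof -
    obtain a where a: "x = (a, a * m)" using xm by (auto simp: proj_pt_iff smul_def)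
    hence "a \<noteq> 0" using x(1) by (auto simp: zero_prod_def)
    thus ?thesis using a by simp
  qed
  have vertical_fst: "fst x = 0" if "x \<in> proj_pt (0, 1)"
    using that by (auto simp: proj_pt_iff smul_def)
  have graphs: "smul h ` U_poly f = smul k ` U_poly f"
    if hk: "x \<in> smul h ` U_poly f" "x \<in> smul k ` U_poly f" for h k
  proof -
    obtain y where y: "x = smul h (y, poly f y)" using hk(1) by (auto simp: U_poly_def)
    obtain z where z: "x = smul k (z, poly f z)" using hk(2) by (auto simp: U_poly_def)
    have nz: "h \<noteq> 0" "k \<noteq> 0" "y \<noteq> 0" "z \<noteq> 0"
      using y z x(1) poly_zero by (auto simp: smul_def prod_eq_iff)
    have eq: "h * y = k * z" "h * poly f y = k * poly f z" using y z by (auto simp: smul_def)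
    \<comment> \<open>Multiplying the two coordinate equations crosswise lets \<open>h\<close> and
      \<open>k\<close> cancel, leaving the hypothesis of scatteredness.\<close>
    have "h * (k * (z * poly f y)) = (k * z) * (h * poly f y)" by (simp add: ac_simps)
    also have "\<dots> = h * (k * (y * poly f z))" unfolding eq(2) eq(1)[symmetric] by (simp add: ac_simps)
    finally have "z * poly f y = y * poly f z" using nz by simp
    then obtain a where a: "a \<in> K" "z = a * y" using scattered_poly_dependent nz by blast
    hence "h = a * k" using eq(1) nz by simp
    moreover have "a \<in> K - {0}" using a nz by auto
    ultimately show ?thesis using smul_U_poly_cong by simp
  qed
  show ?thesis
    using V
  proof (cases rule: spread_cases)
    case V: (slope m)
    show ?thesis
      using W by (cases rule: spread_cases) (use V x point fst_x slope_fst in \<open>metis\<close>)+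
  next
    case V: vertical
    show ?thesis
      using W by (cases rule: spread_cases) (use V x point fst_x vertical_fst in \<open>metis\<close>)+
  next
    case V: (graph h)
    show ?thesis
      using W by (cases rule: spread_cases) (use V x graphs fst_x slope_fst vertical_fst in \<open>metis\<close>)+
  qed
qed

lemma spread_cover: "\<exists>V\<in>spread_of_poly f. x \<in> V"
proof (cases "fst x = 0")
  case True
  hence "x \<in> {0} \<times> UNIV" by (simp add: mem_Times_iff)
  thus ?thesis unfolding spread_of_poly_def by blast
next
  case False
  show ?thesis
  proof (cases "snd x / fst x \<in> L_poly f")
    case True
    then obtain z where z: "snd x / fst x = poly f z / z" "z \<noteq> 0" by (auto simp: L_poly_def)
    have "x = smul (fst x / z) (z, poly f z)"
      using z False by (simp add: smul_def prod_eq_iff field_simps)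
    hence "x \<in> smul (fst x / z) ` U_poly f" unfolding U_poly_def by blast
    moreover have "fst x / z \<noteq> 0" using False z by simp
    ultimately show ?thesis unfolding spread_of_poly_def by blast
  next
    case nL: False
    have "x = smul (fst x) (1, snd x / fst x)" using False by (simp add: smul_def prod_eq_iff)
    hence "x \<in> proj_pt (1, snd x / fst x)" using proj_pt_iff by blast
    thus ?thesis using nL unfolding spread_of_poly_def by blast
  qed
qed

lemma planar_spread_of_poly: "planar_spread (spread_of_poly f)"
  unfolding planar_spread_def
proof (intro conjI ballI allI impI)
  fix V assume V: "V \<in> spread_of_poly f"
  have card: "card V = card (UNIV :: 'a set)" by (rule card_component[OF V])
  hence "V \<noteq> {}" by auto
  then obtain v where "v \<in> V" by blast
  show zero: "0 \<in> V" using component_diff[OF V \<open>v \<in> V\<close> \<open>v \<in> V\<close>] by simp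
  \<comment> \<open>Two field elements give N < N^2, so a component of size N is proper.\<close>
  have "card {0 :: 'a, 1} \<le> card (UNIV :: 'a set)" by (intro card_mono) auto
  hence "card (UNIV :: 'a set) < card (UNIV :: 'a set) * card (UNIV :: 'a set)" by simp
  thus "V \<noteq> UNIV" using card by (auto simp: card_cartesian_product simp flip: UNIV_Times_UNIV)
  show "x - y \<in> V" if "x \<in> V" "y \<in> V" for x y using component_diff V that by blast
  fix W assume W: "W \<in> spread_of_poly f" and ne: "V \<noteq> W"
  have "card W = card (UNIV :: 'a set)" by (rule card_component[OF W])
  hence "W \<noteq> {}" by auto
  then obtain w where "w \<in> W" by blast
  have "0 \<in> W" using component_diff[OF W \<open>w \<in> W\<close> \<open>w \<in> W\<close>] by simp
  have Int: "x = 0" if "x \<in> V" "x \<in> W" for x using component_eqI[OF V W] ne that by blast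
  thus "V \<inter> W = {0}" using zero \<open>0 \<in> W\<close> by blast
  show "\<exists>v\<in>V. \<exists>w\<in>W. x = v + w" for x
    by (rule complementary_subgroups) (use component_diff V W Int card_component in auto)
qed (rule spread_cover)

section \<open>Counting slopes and multiples of the graph\<close>

lemma card_unit_K: "card (K - {0}) = card K - 1"
  using K by (simp add: is_subfield_def)

text \<open>By K-linearity the quotient f(x)/x is unchanged when x is scaled by K, so each value
  occurs at least q - 1 times.\<close>

lemma card_L_poly: "card (L_poly f) * (card K - 1) \<le> card (UNIV :: 'a set) - 1"
proof -
  have L: "L_poly f = (\<lambda>x. poly f x / x) ` (UNIV - {0})" by (auto simp: L_poly_def)
  have "card (L_poly f) * card (K - {0}) \<le> card (UNIV - {0 :: 'a})"
    unfolding L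
    by (rule card_image_mult_le[where act = "(*)"]) (use lin in \<open>auto simp: K_linear_def intro: inj_onI\<close>)
  thus ?thesis by (simp add: card_unit_K)
qed

lemma card_graph_components:
  "card ((\<lambda>h. smul h ` U_poly f) ` (UNIV - {0})) * (card K - 1) \<le> card (UNIV :: 'a set) - 1"
proof -
  have "card ((\<lambda>h. smul h ` U_poly f) ` (UNIV - {0})) * card (K - {0}) \<le> card (UNIV - {0 :: 'a})"
    by (rule card_image_mult_le[where act = "(*)"]) (use smul_U_poly_cong in \<open>auto intro: inj_onI\<close>)
  thus ?thesis by (simp add: card_unit_K)
qed

text \<open>Separates the graph from the points: closure under all scalars would give f(x) = x f(1),
  and scatteredness would put every x into K.\<close>

lemma U_poly_not_homogeneous:
  assumes "K \<noteq> UNIV"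
  shows "\<exists>u\<in>U_poly f. \<exists>a. smul a u \<notin> U_poly f"
proof (rule ccontr)
  assume H: "\<not> ?thesis"
  have "x \<in> K" for x
  proof -
    have "smul x (1, poly f 1) \<in> U_poly f" using H by (auto simp: U_poly_def)
    hence "poly f x = x * poly f 1" by (auto simp: U_poly_def smul_def)
    hence "\<exists>a\<in>K. x = a * 1" by (intro scattered_poly_dependent) auto
    thus ?thesis by simp
  qed
  thus False using assms by blast
qed

end

section \<open>Isomorphic planes come from equivalent subspaces\<close>

lemma GammaL_comp:
  assumes "\<kappa> \<in> GammaL" "\<mu> \<in> GammaL"
  shows "\<kappa> \<circ> \<mu> \<in> GammaL"
proof -
  obtain \<sigma> where \<kappa>: "bij \<kappa>" "\<And>u v. \<kappa> (u + v) = \<kappa> u + \<kappa> v"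
    and \<sigma>: "bij \<sigma>" "\<And>x y. \<sigma> (x + y) = \<sigma> x + \<sigma> y" "\<And>x y. \<sigma> (x * y) = \<sigma> x * \<sigma> y"
    "\<And>a v. \<kappa> (smul a v) = smul (\<sigma> a) (\<kappa> v)"
    using assms(1) unfolding GammaL_def by blast
  obtain \<tau> where \<mu>: "bij \<mu>" "\<And>u v. \<mu> (u + v) = \<mu> u + \<mu> v"
    and \<tau>: "bij \<tau>" "\<And>x y. \<tau> (x + y) = \<tau> x + \<tau> y" "\<And>x y. \<tau> (x * y) = \<tau> x * \<tau> y"
    "\<And>a v. \<mu> (smul a v) = smul (\<tau> a) (\<mu> v)"
    using assms(2) unfolding GammaL_def by blast
  show ?thesis
    unfolding GammaL_def mem_Collect_eq
    by (intro conjI allI exI[of _ "\<sigma> \<circ> \<tau>"]) (simp_all add: \<kappa> \<mu> \<sigma> \<tau> bij_comp)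
qed

lemma GammaL_inv:
  assumes "\<kappa> \<in> GammaL"
  shows "inv \<kappa> \<in> GammaL"
proof -
  obtain \<sigma> where \<kappa>: "bij \<kappa>" "\<And>u v. \<kappa> (u + v) = \<kappa> u + \<kappa> v"
    and \<sigma>: "bij \<sigma>" "\<And>x y. \<sigma> (x + y) = \<sigma> x + \<sigma> y" "\<And>x y. \<sigma> (x * y) = \<sigma> x * \<sigma> y"
    "\<And>a v. \<kappa> (smul a v) = smul (\<sigma> a) (\<kappa> v)"
    using assms unfolding GammaL_def by blast
  have k: "\<kappa> (inv \<kappa> v) = v" "inv \<kappa> (\<kappa> v) = v" for v
    using \<kappa>(1) by (simp_all add: bij_is_surj bij_is_inj surj_f_inv_f)
  have s: "\<sigma> (inv \<sigma> x) = x" "inv \<sigma> (\<sigma> x) = x" for x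
    using \<sigma>(1) by (simp_all add: bij_is_surj bij_is_inj surj_f_inv_f)
  show ?thesis
    unfolding GammaL_def mem_Collect_eq
  proof (intro conjI allI exI)
    show "bij (inv \<kappa>)" "bij (inv \<sigma>)" using \<kappa> \<sigma> by (simp_all add: bij_imp_bij_inv)
    show "inv \<kappa> (u + v) = inv \<kappa> u + inv \<kappa> v" for u v using \<kappa>(2) k by metis
    show "inv \<sigma> (x + y) = inv \<sigma> x + inv \<sigma> y" for x y using \<sigma>(2) s by metis
    show "inv \<sigma> (x * y) = inv \<sigma> x * inv \<sigma> y" for x y using \<sigma>(3) s by metis
    show "inv \<kappa> (smul a v) = smul (inv \<sigma> a) (inv \<kappa> v)" for a v using \<sigma>(4) s k by metis
  qed
qed

lemma linear_in_GammaL: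
  assumes "Vector_Spaces.linear smul smul \<phi>" "bij \<phi>"
  shows "\<phi> \<in> GammaL"
  using assms unfolding GammaL_def Vector_Spaces.linear_iff by (auto intro!: exI[of _ id])

lemma smul_in_GammaL: "h \<noteq> 0 \<Longrightarrow> smul h \<in> GammaL"
proof (rule linear_in_GammaL)
  assume h: "h \<noteq> 0"
  show "Vector_Spaces.linear smul smul (smul h)"
    unfolding Vector_Spaces.linear_iff
    using vector_space_smul by (auto simp: smul.scale_right_distrib mult.commute)
  show "bij (smul h)"
    by (rule bij_betw_byWitness[where f' = "smul (inverse h)"]) (use h smul_inverse_smul in auto)
qed

lemma planes_isomorphic_imp_equivalent:
  fixes K :: "'a::{field,finite} set" and f g :: "'a poly"
  assumes K: "is_subfield K" "card K > 3" "K \<noteq> UNIV"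
    and f: "K_linear K (poly f)" "scattered_poly K f"
    and g: "K_linear K (poly g)" "scattered_poly K g"
    and iso: "planes_isomorphic (plane_of_poly f) (plane_of_poly g)"
  shows "\<exists>\<kappa>\<in>GammaL. U_poly g = \<kappa> ` U_poly f"
proof -
  let ?N = "card (UNIV :: 'a set)"
  obtain \<phi> where bij: "bij \<phi>" and add: "\<And>x y. \<phi> (x + y) = \<phi> x + \<phi> y"
    and comp: "\<And>V. V \<in> spread_of_poly f \<Longrightarrow> \<phi> ` V \<in> spread_of_poly g"
    using planes_isomorphic_imp_additive[OF planar_spread_of_poly[OF K(1) f] planar_spread_of_poly[OF K(1) g]]
      iso unfolding plane_of_poly_def by blast
  \<comment> \<open>\<open>D\<close> holds the points in the first spread, \<open>R\<close> the
    multiples of the graph in the second, and \<open>S\<close> the points sent to points.\<close>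
  define D where "D = insert (proj_pt (0, 1)) ((\<lambda>m. proj_pt (1, m)) ` (UNIV - L_poly f))"
  define R where "R = (\<lambda>h. smul h ` U_poly g) ` (UNIV - {0})"
  define S where "S = {P \<in> D. \<phi> ` P \<notin> R}"
  have ne: "(1, m) \<noteq> (0 :: 'a \<times> 'a)" for m by (simp add: prod_eq_iff)
  have ne': "(0, 1) \<noteq> (0 :: 'a \<times> 'a)" by (simp add: prod_eq_iff)
  have D_spread: "D \<subseteq> spread_of_poly f"
    unfolding D_def spread_of_poly_def proj_pt_zero_one by blast
  have points: "\<exists>v w. v \<noteq> 0 \<and> P = proj_pt v \<and> \<phi> ` P = proj_pt w" if P: "P \<in> S" for P
  proof -
    have "\<exists>v. v \<noteq> 0 \<and> P = proj_pt v" using P ne ne' unfolding S_def D_def by blast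
    moreover have "\<phi> ` P \<in> spread_of_poly g" "\<phi> ` P \<notin> R" using P comp D_spread unfolding S_def by auto
    hence "\<exists>w. \<phi> ` P = proj_pt w"
      unfolding R_def spread_of_poly_def proj_pt_zero_one[symmetric] by blast
    ultimately show ?thesis by blast
  qed
  have card_D: "card D = ?N - card (L_poly f) + 1"
  proof -
    have "inj (\<lambda>m :: 'a. proj_pt (1, m))"
      using ne by (auto intro!: injI simp: proj_pt_eq_iff smul_def)
    hence "card ((\<lambda>m. proj_pt (1, m)) ` (UNIV - L_poly f)) = card (UNIV - L_poly f)"
      by (metis card_image inj_on_subset subset_UNIV)
    moreover have "proj_pt (0, 1) \<notin> (\<lambda>m. proj_pt (1, m)) ` (UNIV - L_poly f)"
      using ne by (auto simp: eq_commute[of "proj_pt (0, 1)"] proj_pt_eq_iff smul_def)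
    ultimately show ?thesis unfolding D_def by (simp add: card_Diff_subset)
  qed
  \<comment> \<open>Distinct points have distinct images, so at most \<open>card R\<close> points of
    \<open>D\<close> are lost.\<close>
  have "card {P \<in> D. \<phi> ` P \<in> R} \<le> card R"
    using bij by (intro card_inj_on_le[of "(`) \<phi>"])
      (auto simp: R_def intro!: inj_onI simp: bij_is_inj inj_image_eq_iff)
  moreover have "card D = card S + card {P \<in> D. \<phi> ` P \<in> R}"
    unfolding S_def by (subst card_Un_disjoint[symmetric]) (auto intro!: arg_cong[where f = card])
  ultimately have card_S: "?N + 1 \<le> card S + card R + card (L_poly f)"
    using card_D by linarith
  \<comment> \<open>Here q > 3 enters, in the form q - 1 >= 3.\<close>
  have "card (L_poly f) * 3 \<le> card (L_poly f) * (card K - 1)" using K by (intro mult_le_mono2) simp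
  hence L3: "3 * card (L_poly f) \<le> ?N - 1" using card_L_poly[OF K(1) f] by linarith
  have "card R * 3 \<le> card R * (card K - 1)" using K by (intro mult_le_mono2) simp
  hence R3: "3 * card R \<le> ?N - 1" using card_graph_components[OF K(1) g] unfolding R_def by linarith
  \<comment> \<open>K is proper and q >= 4, so N >= q^2 >= 16.\<close>
  have N16: "16 \<le> ?N"
  proof -
    have "4 ^ 2 \<le> card K ^ 2" using K by (intro power_mono) auto
    thus ?thesis using square_card_proper_subfield[OF K(1,3)] by simp
  qed
  have S3: "?N + 2 \<le> 3 * (card S - 1)" using card_S L3 R3 N16 by linarith
  hence "(?N + 2) ^ 2 \<le> (3 * (card S - 1)) ^ 2" by (intro power_mono) auto
  moreover have "9 * ?N < (?N + 2) ^ 2"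
  proof -
    have "16 * ?N \<le> ?N * ?N" using N16 by (rule mult_le_mono1)
    moreover have "(?N + 2) ^ 2 = ?N * ?N + 4 * ?N + 4" by (simp add: power2_eq_square algebra_simps)
    ultimately show ?thesis using N16 by linarith
  qed
  ultimately have "9 * ?N < 9 * (card S - 1) ^ 2" by (simp add: power_mult_distrib)
  hence "?N < (card S - 1) ^ 2" by simp
  moreover have "3 \<le> card S" using S3 N16 by linarith
  ultimately have \<phi>: "\<phi> \<in> GammaL"
    using additive_preserving_points_in_GammaL[OF bij add points] by blast
  have "U_poly f \<in> {smul h ` U_poly f | h. h \<noteq> 0}"
    by (intro CollectI exI[of _ 1]) simp
  hence "U_poly f \<in> spread_of_poly f" unfolding spread_of_poly_def by blast
  hence im: "\<phi> ` U_poly f \<in> spread_of_poly g" by (rule comp)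
  \<comment> \<open>A point is closed under all scalars, and semilinearity would pull this closure
    back to \<open>U_poly f\<close>.\<close>
  have not_point: "\<phi> ` U_poly f \<noteq> proj_pt w" for w
  proof
    assume eq: "\<phi> ` U_poly f = proj_pt w"
    obtain \<sigma> where \<sigma>: "\<And>a v. \<phi> (smul a v) = smul (\<sigma> a) (\<phi> v)" using \<phi> unfolding GammaL_def by blast
    have "smul a u \<in> U_poly f" if u: "u \<in> U_poly f" for a u
    proof -
      obtain b where "\<phi> u = smul b w" using u eq proj_pt_iff by blast
      hence "\<phi> (smul a u) = smul (\<sigma> a * b) w" by (simp add: \<sigma>)
      hence "\<phi> (smul a u) \<in> \<phi> ` U_poly f" unfolding eq proj_pt_iff by blast
      thus ?thesis using bij by (simp add: bij_is_inj inj_image_mem_iff)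
    qed
    thus False using U_poly_not_homogeneous[OF K(1) f K(3)] by blast
  qed
  from im obtain h where h: "h \<noteq> 0" "\<phi> ` U_poly f = smul h ` U_poly g"
    by (cases rule: spread_cases) (use not_point in blast)+
  \<comment> \<open>The multiplier \<open>h\<close> is absorbed, since scalings are in
    \<open>GammaL\<close>.\<close>
  have "(smul (inverse h) \<circ> \<phi>) ` U_poly f = U_poly g"
    unfolding image_comp[symmetric] h(2) using h(1) by (simp add: image_image)
  moreover have "smul (inverse h) \<circ> \<phi> \<in> GammaL"
    using GammaL_comp[OF smul_in_GammaL \<phi>] h(1) by simp
  ultimately show ?thesis by blast
qed

section \<open>Moving a point off the linear set to infinity\<close>

text \<open>Taking the determinant with \<open>w\<close> as first coordinate makes the point of
  \<open>w\<close> vertical; the second coordinate is chosen so that the map is invertible.\<close>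

lemma exists_linear_to_infinity:
  fixes w :: "'a::field \<times> 'a"
  assumes "w \<noteq> 0"
  shows "\<exists>\<phi>. Vector_Spaces.linear smul smul \<phi> \<and> bij \<phi> \<and>
    (\<forall>v. fst (\<phi> v) = 0 \<longrightarrow> fst w * snd v = snd w * fst v)"
proof -
  define a b where "a = fst w" and "b = snd w"
  define \<phi> where "\<phi> v = (a * snd v - b * fst v, if a = 0 then snd v else fst v)" for v
  have ab: "a \<noteq> 0 \<or> b \<noteq> 0" using assms by (auto simp: a_def b_def prod_eq_iff)
  have "Vector_Spaces.linear smul smul \<phi>"
    unfolding Vector_Spaces.linear_iff using vector_space_smul
    by (auto simp: \<phi>_def smul_def algebra_simps)
  moreover have "bij \<phi>"
  proof (cases "a = 0")
    case True
    show ?thesis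
      by (rule bij_betw_byWitness[where f' = "\<lambda>v. (- fst v / b, snd v)"])
        (use True ab in \<open>auto simp: \<phi>_def\<close>)
  next
    case False
    show ?thesis
      by (rule bij_betw_byWitness[where f' = "\<lambda>v. (snd v, (fst v + b * snd v) / a)"])
        (use False in \<open>auto simp: \<phi>_def\<close>)
  qed
  moreover have "fst (\<phi> v) = 0 \<longrightarrow> fst w * snd v = snd w * fst v" for v
    by (simp add: \<phi>_def a_def b_def)
  ultimately show ?thesis by blast
qed

lemma scattered_space_image:
  assumes lin: "Vector_Spaces.linear smul smul \<phi>" and bij: "bij \<phi>" and U: "scattered_space K U"
  shows "scattered_space K (\<phi> ` U)"
proof -
  have add: "\<phi> (u + v) = \<phi> u + \<phi> v" and sc: "\<phi> (smul a v) = smul a (\<phi> v)" for u v a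
    using lin unfolding Vector_Spaces.linear_iff by blast+
  have \<phi>0: "\<phi> 0 = 0" using sc[of 0 0] by simp
  have inj: "inj \<phi>" using bij by (rule bij_is_inj)
  have "K_subspace K (\<phi> ` U)"
    unfolding K_subspace_def
  proof (intro conjI ballI)
    have U': "K_subspace K U" using U by (simp add: scattered_space_def)
    show "0 \<in> \<phi> ` U" using U' \<phi>0 by (force simp: K_subspace_def)
    show "u + v \<in> \<phi> ` U" if uv: "u \<in> \<phi> ` U" "v \<in> \<phi> ` U" for u v
    proof -
      obtain u' v' where "u' \<in> U" "v' \<in> U" "u = \<phi> u'" "v = \<phi> v'" using uv by blast
      moreover have "u' + v' \<in> U" using U' calculation by (simp add: K_subspace_def)
      ultimately show ?thesis using add by (metis imageI)
    qed
    show "smul a u \<in> \<phi> ` U" if a: "a \<in> K" "u \<in> \<phi> ` U" for a u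
    proof -
      obtain u' where "u' \<in> U" "u = \<phi> u'" using a by blast
      moreover have "smul a u' \<in> U" using U' a calculation by (simp add: K_subspace_def)
      ultimately show ?thesis using sc by (metis imageI)
    qed
  qed
  moreover have "card (\<phi> ` U) = card U" using inj by (metis card_image inj_on_subset subset_UNIV)
  moreover have "a \<in> K" if u: "u \<in> \<phi> ` U" "u \<noteq> 0" "smul a u \<in> \<phi> ` U" for u a
  proof -
    obtain u' where u': "u' \<in> U" "u = \<phi> u'" using u by blast
    have "smul a u' \<in> U" using u(3) u'(2) inj by (simp add: inj_image_mem_iff flip: sc)
    moreover have "u' \<noteq> 0" using u u' \<phi>0 by auto
    ultimately show ?thesis using U u'(1) unfolding scattered_space_def by blast
  qed
  ultimately show ?thesis using U unfolding scattered_space_def by metis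
qed

lemma lin_set_image:
  assumes lin: "Vector_Spaces.linear smul smul \<phi>" and bij: "bij \<phi>"
  shows "\<phi> ` proj_pt v = proj_pt (\<phi> v)" "lin_set (\<phi> ` U) = (`) \<phi> ` lin_set U"
proof -
  have sc: "\<phi> (smul a v) = smul a (\<phi> v)" for a v
    using lin unfolding Vector_Spaces.linear_iff by blast
  have \<phi>0: "\<phi> 0 = 0" using sc[of 0 0] by simp
  show pt: "\<phi> ` proj_pt v = proj_pt (\<phi> v)" for v
    by (simp add: proj_pt_eq_range image_image sc)
  have "\<phi> ` U - {0} = \<phi> ` (U - {0})"
    using bij_is_inj[OF bij] \<phi>0 image_set_diff[of \<phi> U "{0}"] by simp
  moreover have "lin_set W = proj_pt ` (W - {0})" for W :: "('a \<times> 'a) set"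
    unfolding lin_set_def by blast
  ultimately show "lin_set (\<phi> ` U) = (`) \<phi> ` lin_set U" by (simp add: image_image pt)
qed

text \<open>For nonzero y the equation says that (z, f(z)) is z/y times (y, f(y)), so z/y lies in
  K.\<close>

lemma scattered_space_imp_scattered_poly:
  assumes K: "is_subfield K" and U: "scattered_space K (U_poly f)"
  shows "scattered_poly K f"
  unfolding scattered_poly_def
proof (intro allI impI)
  fix y z assume "z * poly f y - y * poly f z = 0"
  hence eq: "z * poly f y = y * poly f z" by simp
  show "\<exists>a\<in>K. \<exists>b\<in>K. (a, b) \<noteq> (0, 0) \<and> a * y + b * z = 0"
  proof (cases "y = 0")
    case True
    thus ?thesis using K by (intro bexI[of _ 1] bexI[of _ 0]) (auto simp: is_subfield_def)
  next
    case False
    have "smul (z / y) (y, poly f y) = (z, poly f z)" using eq False by (simp add: smul_def)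
    hence "z / y \<in> K"
      using U False unfolding scattered_space_def
      by (auto simp: U_poly_def prod_eq_iff elim!: ballE[of _ _ "(y, poly f y)"])
    hence "z / y \<in> K" "- 1 \<in> K" using K unfolding is_subfield_def by auto
    thus ?thesis using False by (intro bexI[of _ "z / y"] bexI[of _ "- 1"]) auto
  qed
qed

lemma scattered_space_linearized:
  fixes K :: "'a::{field,finite} set"
  assumes K: "is_subfield K" "primepow (card K)" and N: "card (UNIV :: 'a set) = card K ^ t"
    and U: "scattered_space K U" and vert: "\<And>u. u \<in> U \<Longrightarrow> fst u = 0 \<Longrightarrow> u = 0"
    and t: "t > 0" and span: "\<And>x. \<exists>a. (\<forall>i\<in>{..<t}. a i \<in> K) \<and> x = (\<Sum>i<t. a i * e i)"
  shows "\<exists>f. linearized K f \<and> K_linear K (poly f) \<and> scattered_poly K f \<and> U_poly f = U"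
proof -
  obtain F where F: "K_linear K F" "U = range (\<lambda>x. (x, F x))"
    using scattered_space_is_graph[OF K(1) U vert] by blast
  obtain f where f: "linearized K f" "poly f = F"
    using K_linear_is_linearized[OF K N t span F(1)] by blast
  have "U_poly f = U" using f F by (auto simp: U_poly_def)
  thus ?thesis using f F scattered_space_imp_scattered_poly[OF K(1)] U by blast
qed

section \<open>From the linear set to its planes\<close>

theorem corollary4p6:
  fixes q t c :: nat
    and K :: "'a::{field,finite} set"
    and L :: "('a \<times> 'a) set set"
  assumes "primepow q" and "q > 3" and "t > 1"
    and "card (UNIV :: 'a set) = q ^ t"
    and "is_subfield K" and "card K = q"
    and "scattered_linear_set K t L"
    and "c = GammaL_class K L"
  shows "\<exists>\<kappa> (f :: nat \<Rightarrow> 'a poly). projectivity \<kappa> \<and>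
    (\<forall>i\<in>{1..c}. linearized K (f i) \<and> scattered_poly K (f i) \<and> lin_set (U_poly (f i)) = \<kappa> ` L) \<and>
    (\<forall>i\<in>{1..c}. \<forall>j\<in>{1..c}. i \<noteq> j \<longrightarrow>
       \<not> planes_isomorphic (plane_of_poly (f i)) (plane_of_poly (f j)))"
proof -
  note K = \<open>is_subfield K\<close>
  have cK: "primepow (card K)" "card K > 3" and N: "card (UNIV :: 'a set) = card K ^ t"
    using assms by simp_all
  have "card K ^ 1 < card K ^ t" using cK \<open>t > 1\<close> by (intro power_strict_increasing) auto
  hence KN: "card K < card (UNIV :: 'a set)" using N by simp
  hence K_proper: "K \<noteq> UNIV" by auto
  \<comment> \<open>Scatteredness is stated with \<open>div\<close>, so the division must be exact
    before multiplying out.\<close>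
  have "card K - 1 dvd card K ^ n - 1" for n
  proof (induction n)
    case (Suc n)
    have "1 \<le> card K ^ n" using cK by simp
    hence "card K ^ Suc n - 1 = card K * (card K ^ n - 1) + (card K - 1)"
      using cK by (simp add: diff_mult_distrib2)
    thus ?case using Suc by (metis dvd_add dvd_mult dvd_refl)
  qed simp
  hence "card L * (card K - 1) = card K ^ t - 1"
    using assms(7) by (simp add: scattered_linear_set_def)
  hence card_L: "card L * (card K - 1) + 1 = card (UNIV :: 'a set)" using N KN by simp
  \<comment> \<open>\<open>GammaL_class\<close> prescribes no rank for the representatives; their
    size and scatteredness follow from L alone.\<close>
  have scatt: "scattered_space K U" if "K_subspace K U" "lin_set U = L" for U
    using scattered_spaceI[OF K that(1)] that(2) card_L by simp
  have "card L * 1 \<le> card L * (card K - 1)" using cK by (intro mult_le_mono2) simp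
  hence "card L < card (UNIV :: 'a set)" using card_L by linarith
  then obtain w where w: "w \<noteq> 0" "proj_pt w \<notin> L" using card_all_points[of L] by fastforce
  obtain \<phi> where lin: "Vector_Spaces.linear smul smul \<phi>" and bij: "bij \<phi>"
    and inf: "\<And>v. fst (\<phi> v) = 0 \<Longrightarrow> fst w * snd v = snd w * fst v"
    using exists_linear_to_infinity[OF w(1)] by blast
  have \<phi>_add: "\<phi> (u + v) = \<phi> u + \<phi> v" and \<phi>_smul: "\<phi> (smul a v) = smul a (\<phi> v)" for u v a
    using lin unfolding Vector_Spaces.linear_iff by blast+
  have \<phi>0: "\<phi> 0 = 0" using \<phi>_smul[of 0 0] by simp
  \<comment> \<open>A vector mapped to first coordinate 0 lies on the point of \<open>w\<close>,
    which is not in L.\<close>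
  have vert: "u = 0" if "lin_set U = L" and u: "u \<in> \<phi> ` U" "fst u = 0" for U u
  proof (rule ccontr)
    assume "u \<noteq> 0"
    obtain v where v: "v \<in> U" "u = \<phi> v" using u by blast
    hence "v \<noteq> 0" using \<open>u \<noteq> 0\<close> \<phi>0 by auto
    hence "proj_pt v = proj_pt w" using inf[of v] u v w(1) by (intro proj_pt_eqI_det) auto
    moreover have "proj_pt v \<in> lin_set U" using v \<open>v \<noteq> 0\<close> unfolding lin_set_def by blast
    ultimately show False using w(2) that(1) by simp
  qed
  obtain U0 where U0: "K_subspace K U0" "K_dim K U0 t" "lin_set U0 = L"
    using assms(7) unfolding scattered_linear_set_def linear_set_of_rank_def by blast
  obtain b where b: "U0 = {(\<Sum>i<t. smul (a i) (b i)) | a. \<forall>i<t. a i \<in> K}"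
    using U0(2) unfolding K_dim_def by blast
  \<comment> \<open>The image of \<open>U0\<close> is a graph, so every field element is a first
    coordinate in it. A K-basis of \<open>U0\<close> thus supplies t generators of the field over
    K.\<close>
  have span: "\<exists>a. (\<forall>i\<in>{..<t}. a i \<in> K) \<and> x = (\<Sum>i<t. a i * fst (\<phi> (b i)))" for x
  proof -
    obtain F where F: "\<phi> ` U0 = range (\<lambda>x. (x, F x))"
      using scattered_space_is_graph[OF K scattered_space_image[OF lin bij scatt[OF U0(1,3)]] vert[OF U0(3)]]
      by blast
    hence "(x, F x) \<in> \<phi> ` U0" by blast
    then obtain a where a: "\<forall>i<t. a i \<in> K" "(x, F x) = \<phi> (\<Sum>i<t. smul (a i) (b i))"
      unfolding b by blast
    have "\<phi> (\<Sum>i<n. smul (a i) (b i)) = (\<Sum>i<n. smul (a i) (\<phi> (b i)))" for n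
      by (induction n) (simp_all add: \<phi>0 \<phi>_add \<phi>_smul)
    hence "x = fst (\<Sum>i<t. smul (a i) (\<phi> (b i)))" using a(2) by (metis fst_conv)
    hence "x = (\<Sum>i<t. a i * fst (\<phi> (b i)))" by (simp add: fst_sum smul_def)
    thus ?thesis using a(1) by blast
  qed
  let ?P = "\<lambda>c. \<exists>U :: nat \<Rightarrow> ('a \<times> 'a) set.
     (\<forall>i\<in>{1..c}. K_subspace K (U i) \<and> lin_set (U i) = L) \<and>
     (\<forall>i\<in>{1..c}. \<forall>j\<in>{1..c}. i \<noteq> j \<longrightarrow> \<not> (\<exists>\<kappa>\<in>GammaL. U i = \<kappa> ` U j))"
  have "?P c"
    unfolding assms(8) GammaL_class_def
  \<comment> \<open>The greatest value is attained because it is bounded: the identity, as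
    \<open>smul 1\<close>, makes inequivalent representatives distinct, and there are finitely many
    sets of vectors.\<close>
  proof (rule GreatestI_nat[of ?P 0 "card (UNIV :: ('a \<times> 'a) set set)"])
    show "?P 0" by simp
    fix d assume "?P d"
    then obtain U :: "nat \<Rightarrow> ('a \<times> 'a) set" where
      U: "\<forall>i\<in>{1..d}. \<forall>j\<in>{1..d}. i \<noteq> j \<longrightarrow> \<not> (\<exists>\<kappa>\<in>GammaL. U i = \<kappa> ` U j)"
      by (elim exE conjE)
    have "inj_on U {1..d}"
    proof (rule inj_onI, rule ccontr)
      fix i j assume "i \<in> {1..d}" "j \<in> {1..d}" "U i = U j" "i \<noteq> j"
      moreover have "U j = smul 1 ` U j" by simp
      moreover have "smul (1 :: 'a) \<in> GammaL" by (rule smul_in_GammaL) simp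
      ultimately show False using U by metis
    qed
    thus "d \<le> card (UNIV :: ('a \<times> 'a) set set)"
      using card_inj_on_le[of U "{1..d}" UNIV] by simp
  qed
  then obtain U :: "nat \<Rightarrow> ('a \<times> 'a) set" where
    U': "\<forall>i\<in>{1..c}. K_subspace K (U i) \<and> lin_set (U i) = L"
    and inequiv: "\<forall>i\<in>{1..c}. \<forall>j\<in>{1..c}. i \<noteq> j \<longrightarrow> \<not> (\<exists>\<kappa>\<in>GammaL. U i = \<kappa> ` U j)"
    by (elim exE conjE)
  have U: "K_subspace K (U i)" "lin_set (U i) = L" if "i \<in> {1..c}" for i
    using U' that by simp_all
  have "\<exists>f. linearized K f \<and> K_linear K (poly f) \<and> scattered_poly K f \<and> U_poly f = \<phi> ` U i"
    if i: "i \<in> {1..c}" for i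
  proof (rule scattered_space_linearized[OF K cK(1) N])
    show "scattered_space K (\<phi> ` U i)" using scattered_space_image[OF lin bij scatt] U i by blast
    show "u = 0" if "u \<in> \<phi> ` U i" "fst u = 0" for u using vert[OF U(2)[OF i] that] .
  qed (use span \<open>t > 1\<close> in auto)
  then obtain f where f: "\<And>i. i \<in> {1..c} \<Longrightarrow> linearized K (f i)"
    "\<And>i. i \<in> {1..c} \<Longrightarrow> K_linear K (poly (f i))" "\<And>i. i \<in> {1..c} \<Longrightarrow> scattered_poly K (f i)"
    "\<And>i. i \<in> {1..c} \<Longrightarrow> U_poly (f i) = \<phi> ` U i"
    by metis
  have noniso: "\<not> planes_isomorphic (plane_of_poly (f i)) (plane_of_poly (f j))"
    if ij: "i \<in> {1..c}" "j \<in> {1..c}" "i \<noteq> j" for i j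
  proof
    assume "planes_isomorphic (plane_of_poly (f i)) (plane_of_poly (f j))"
    \<comment> \<open>The equivalence carries the representative for \<open>i\<close> to the one for
      \<open>j\<close>. Conjugating it by \<open>\<phi>\<close> relates the original subspaces, and
      \<open>inequiv\<close> is used at \<open>j\<close>, \<open>i\<close>.\<close>
    then obtain \<kappa> where \<kappa>: "\<kappa> \<in> GammaL" "\<phi> ` U j = \<kappa> ` \<phi> ` U i"
      using planes_isomorphic_imp_equivalent[OF K cK(2) K_proper] f ij by metis
    have "U j = inv \<phi> ` \<phi> ` U j" using bij by (simp add: bij_is_inj image_image)
    also have "\<dots> = (inv \<phi> \<circ> (\<kappa> \<circ> \<phi>)) ` U i" unfolding \<kappa>(2) by (simp add: image_comp)
    finally have "U j = (inv \<phi> \<circ> (\<kappa> \<circ> \<phi>)) ` U i" .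
    moreover have "inv \<phi> \<circ> (\<kappa> \<circ> \<phi>) \<in> GammaL"
      using linear_in_GammaL[OF lin bij] \<kappa>(1) by (intro GammaL_comp GammaL_inv)
    ultimately show False using inequiv[rule_format, of j i] ij by blast
  qed
  have "projectivity ((`) \<phi>)"
    unfolding projectivity_def using lin bij lin_set_image(1)[OF lin bij] by blast
  moreover have "lin_set (U_poly (f i)) = (`) \<phi> ` L" if "i \<in> {1..c}" for i
    using lin_set_image(2)[OF lin bij, of "U i"] f(4) U(2) that by simp
  ultimately show ?thesis using f noniso by (intro exI[of _ "(`) \<phi>"] exI[of _ f]) auto
qed

end
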